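(* Let $(G,\tau)$ be a Hausdorff right topological group which is either $\sigma$-locally compact and admissible, or compact, and let $H\subset\Lambda(G)$ be a normal compact topological subgroup of $G$. Then $\lambda_H\in\mathcal{M}(G)$. If $G$ is compact and $H$ is $\sigma\sigma$-closed, then $\lambda_H\in\mathcal{M}_\sigma(G)$ and $G$ has a (right) Haar measure.
   Context: A right topological group is a group $G$ with a topology $\tau$ such that for every $x\in G$ the map $g\mapsto gx$ is continuous. Its topological center is $\Lambda(G)=\{x\in G : g\mapsto xg \text{ is continuous}\}$; $G$ is admissible if $\Lambda(G)$ is dense. "$\sigma$-locally compact" means locally compact and $\sigma$-compact. The $\sigma$-topology on $G$ is the quotient topology on $G$ induced by $(G,\tau)\times(G,\tau)\to G$, $(x,y)\mapsto x^{-1}y$; the $\sigma\sigma$-topology is the quotient topology on $G$ induced by $(G,\sigma)\times(G,\sigma)\to G$, $(x,y)\mapsto x^{-1}y$. A right Haar measure on a compact right topological group $G$ is a Radon probability measure $\lambda$ with $\lambda(Eg)=\lambda(E)$ for all $g\in G$ and Borel $E\subset G$. $M(G)$ is the space of complex Radon measures on $(G,\tau)$. For $f\in C_b(G)$ (bounded continuous functions on $(G,\tau)$) and $\mu\in M(G)$, $(f\cdot\mu)(y)=\int f(xy)\,d\mu(x)$. $\mathcal{M}(G)=\{\mu\in M(G): f\cdot\mu\in C_b(G)\ \forall f\in C_b(G)\}$, and for $G$ compact $\mathcal{M}_\sigma(G)=\{\mu\in M(G): f\cdot\mu\in C(G,\sigma)\ \forall f\in C(G)\}$, where $C(G,\sigma)$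 is the set of $\sigma$-continuous complex functions. For $H$ a compact subgroup of $G$ that is a topological group in the subspace topology, with normalized Haar measure $\lambda$, $\lambda_H\in M(G)$ is the measure $f\mapsto\int_H f|_H(x)\,d\lambda(x)$. *)

theory Defs
  imports "HOL-Probability.Probability" "HOL-Algebra.Coset"
begin

section \<open>Topologies\<close>

definition sigma_compact_space :: "'a topology \<Rightarrow> bool" where
  "sigma_compact_space X \<longleftrightarrow>
     (\<exists>K :: nat \<Rightarrow> 'a set. (\<forall>n. compactin X (K n)) \<and> (\<Union>n. K n) = topspace X)"

definition quotient_topology :: "'a topology \<Rightarrow> ('a \<Rightarrow> 'b) \<Rightarrow> 'b topology" where
  "quotient_topology X f =
     topology (\<lambda>U. U \<subseteq> f ` topspace X \<and> openin X {x \<in> topspace X. f x \<in> U})"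

lemma openin_quotient_topology:
  "openin (quotient_topology X f) U \<longleftrightarrow>
     U \<subseteq> f ` topspace X \<and> openin X {x \<in> topspace X. f x \<in> U}"
proof -
  have "istopology (\<lambda>U. U \<subseteq> f ` topspace X \<and> openin X {x \<in> topspace X. f x \<in> U})"
    unfolding istopology_def
  proof (intro conjI allI impI)
    fix S T
    assume S: "S \<subseteq> f ` topspace X \<and> openin X {x \<in> topspace X. f x \<in> S}"
      and T: "T \<subseteq> f ` topspace X \<and> openin X {x \<in> topspace X. f x \<in> T}"
    have eq: "{x \<in> topspace X. f x \<in> S \<inter> T} =
            {x \<in> topspace X. f x \<in> S} \<inter> {x \<in> topspace X. f x \<in> T}"
      by auto
    show "openin X {x \<in> topspace X. f x \<in> S \<inter> T}"
      unfolding eq by (rule openin_Int[OF conjunct2[OF S] conjunct2[OF T]])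
    show "S \<inter> T \<subseteq> f ` topspace X"
      using S by blast
  next
    fix \<K>
    assume K: "\<forall>U\<in>\<K>. U \<subseteq> f ` topspace X \<and> openin X {x \<in> topspace X. f x \<in> U}"
    have eq: "{x \<in> topspace X. f x \<in> \<Union>\<K>} = (\<Union>U\<in>\<K>. {x \<in> topspace X. f x \<in> U})"
      by auto
    show "openin X {x \<in> topspace X. f x \<in> \<Union>\<K>}"
      unfolding eq using K by (intro openin_Union) blast
    show "\<Union>\<K> \<subseteq> f ` topspace X"
      using K by blast
  qed
  then show ?thesis
    unfolding quotient_topology_def by (simp add: topology_inverse')
qed

lemma topspace_quotient_topology: "topspace (quotient_topology X f) = f ` topspace X"
proof
  have "{x \<in> topspace X. f x \<in> f ` topspace X} = topspace X"
    by auto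
  then have "openin (quotient_topology X f) (f ` topspace X)"
    by (simp add: openin_quotient_topology)
  then show "f ` topspace X \<subseteq> topspace (quotient_topology X f)"
    by (rule openin_subset)
  show "topspace (quotient_topology X f) \<subseteq> f ` topspace X"
    using openin_quotient_topology[of X f] openin_topspace by blast
qed

lemma quotient_map_quotient_topology: "quotient_map X (quotient_topology X f) f"
  by (auto simp: quotient_map_def topspace_quotient_topology openin_quotient_topology)


section \<open>Groups with a topology\<close>

locale right_topological_group = group G for G (structure) +
  fixes T :: "'a topology"
  assumes topspace_eq: "topspace T = carrier G"
    and continuous_right_translation:
      "x \<in> carrier G \<Longrightarrow> continuous_map T T (\<lambda>g. g \<otimes> x)"

locale topological_group = group G for G (structure) +
  fixes T :: "'a topology"
  assumes topspace_eq: "topspace T = carrier G"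
    and continuous_mult: "continuous_map (prod_topology T T) T (\<lambda>(x, y). x \<otimes> y)"
    and continuous_inv: "continuous_map T T (\<lambda>x. inv x)"

definition topological_center :: "('a, 'b) monoid_scheme \<Rightarrow> 'a topology \<Rightarrow> 'a set" where
  "topological_center G T = {x \<in> carrier G. continuous_map T T (\<lambda>g. x \<otimes>\<^bsub>G\<^esub> g)}"

definition admissible :: "('a, 'b) monoid_scheme \<Rightarrow> 'a topology \<Rightarrow> bool" where
  "admissible G T \<longleftrightarrow> T closure_of (topological_center G T) = topspace T"

definition sigma_topology :: "('a, 'b) monoid_scheme \<Rightarrow> 'a topology \<Rightarrow> 'a topology" where
  "sigma_topology G T =
     quotient_topology (prod_topology T T) (\<lambda>(x, y). (inv\<^bsub>G\<^esub> x) \<otimes>\<^bsub>G\<^esub> y)"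

abbreviation sigma_sigma_topology ::
    "('a, 'b) monoid_scheme \<Rightarrow> 'a topology \<Rightarrow> 'a topology" where
  "sigma_sigma_topology G T \<equiv> sigma_topology G (sigma_topology G T)"

lemma (in group) topspace_sigma_topology:
  assumes "topspace T = carrier G"
  shows "topspace (sigma_topology G T) = carrier G"
proof -
  have "y \<in> (\<lambda>(x, y). inv x \<otimes> y) ` (carrier G \<times> carrier G)" if "y \<in> carrier G" for y
    using that by (intro image_eqI[of _ _ "(\<one>, y)"]) auto
  then show ?thesis
    by (auto simp: sigma_topology_def topspace_quotient_topology assms)
qed


section \<open>Radon measures\<close>

definition borel_of :: "'a topology \<Rightarrow> 'a measure" where
  "borel_of T = sigma (topspace T) {U. openin T U}"

lemma space_borel_of: "space (borel_of T) = topspace T"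
  by (simp add: borel_of_def space_measure_of_conv)

lemma sets_borel_of: "sets (borel_of T) = sigma_sets (topspace T) {U. openin T U}"
  unfolding borel_of_def by (rule sets_measure_of) (auto dest: openin_subset)

text \<open>
  For finite Borel measures on a Hausdorff space, being Radon amounts to inner regularity with
  respect to compact sets on all Borel sets; outer regularity follows by taking complements.
\<close>

definition inner_regular :: "'a topology \<Rightarrow> ('a set \<Rightarrow> ennreal) \<Rightarrow> bool" where
  "inner_regular T \<nu> \<longleftrightarrow>
     (\<forall>E \<in> sets (borel_of T). \<nu> E = (SUP K \<in> {K. compactin T K \<and> K \<subseteq> E}. \<nu> K))"

definition radon_probability :: "'a topology \<Rightarrow> 'a measure \<Rightarrow> bool" where
  "radon_probability T N \<longleftrightarrow>
     prob_space N \<and> sets N = sets (borel_of T) \<and> inner_regular T (emeasure N)"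

definition right_haar_measure ::
    "('a, 'b) monoid_scheme \<Rightarrow> 'a topology \<Rightarrow> 'a measure \<Rightarrow> bool" where
  "right_haar_measure G T N \<longleftrightarrow>
     radon_probability T N \<and>
     (\<forall>g \<in> carrier G. \<forall>E \<in> sets (borel_of T). emeasure N (E #>\<^bsub>G\<^esub> g) = emeasure N E)"


section \<open>Complex Radon measures\<close>

text \<open>
  A complex measure on the measurable space \<open>A\<close> (whose own measure plays no role) is a complex
  set function; its values outside \<open>sets A\<close> are irrelevant.
\<close>

definition complex_measure :: "'a measure \<Rightarrow> ('a set \<Rightarrow> complex) \<Rightarrow> bool" where
  "complex_measure A \<mu> \<longleftrightarrow>
     \<mu> {} = 0 \<and>
     (\<forall>F :: nat \<Rightarrow> 'a set. range F \<subseteq> sets A \<longrightarrow> disjoint_family F \<longrightarrow>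
        (\<lambda>i. \<mu> (F i)) sums \<mu> (\<Union>i. F i))"

definition total_variation :: "'a measure \<Rightarrow> ('a set \<Rightarrow> complex) \<Rightarrow> 'a set \<Rightarrow> ennreal" where
  "total_variation A \<mu> E =
     (SUP F \<in> {F :: nat \<Rightarrow> 'a set. range F \<subseteq> sets A \<and> disjoint_family F \<and> (\<Union>i. F i) = E}.
        \<Sum>i. ennreal (cmod (\<mu> (F i))))"

definition complex_radon_measures :: "'a topology \<Rightarrow> ('a set \<Rightarrow> complex) set" where
  "complex_radon_measures T =
     {\<mu>. complex_measure (borel_of T) \<mu> \<and> inner_regular T (total_variation (borel_of T) \<mu>)}"

text \<open>
  The positive part of a real signed measure \<open>\<nu>\<close> in its Jordan decomposition is
  \<open>E \<mapsto> sup {\<nu> B | B \<subseteq> E measurable}\<close>, and its negative part is the positive part of \<open>-\<nu>\<close>.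
  Since \<open>B = {}\<close> is allowed and \<open>ennreal\<close> truncates negative values to 0, truncation does not
  change the supremum.
\<close>

definition positive_part :: "'a measure \<Rightarrow> ('a set \<Rightarrow> real) \<Rightarrow> 'a measure" where
  "positive_part A \<nu> =
     measure_of (space A) (sets A) (\<lambda>E. SUP B \<in> {B \<in> sets A. B \<subseteq> E}. ennreal (\<nu> B))"

definition complex_integral ::
    "'a measure \<Rightarrow> ('a set \<Rightarrow> complex) \<Rightarrow> ('a \<Rightarrow> complex) \<Rightarrow> complex" where
  "complex_integral A \<mu> f =
     (integral\<^sup>L (positive_part A (\<lambda>E. Re (\<mu> E))) f - integral\<^sup>L (positive_part A (\<lambda>E. - Re (\<mu> E))) f)
     + \<i> * (integral\<^sup>L (positive_part A (\<lambda>E. Im (\<mu> E))) f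
            - integral\<^sup>L (positive_part A (\<lambda>E. - Im (\<mu> E))) f)"


section \<open>The spaces $\mathcal M(G)$ and $\mathcal M_\sigma(G)$\<close>

text \<open>
  Continuity and boundedness are only required on the underlying set of the topology; the values
  of a function outside it play no role.
\<close>

definition continuous_functions :: "'a topology \<Rightarrow> ('a \<Rightarrow> complex) set" where
  "continuous_functions T = {f. continuous_map T euclidean f}"

definition bounded_continuous_functions :: "'a topology \<Rightarrow> ('a \<Rightarrow> complex) set" where
  "bounded_continuous_functions T =
     {f. continuous_map T euclidean f \<and> bounded (f ` topspace T)}"

definition fun_dot_measure ::
    "('a, 'b) monoid_scheme \<Rightarrow> 'a topology \<Rightarrow> ('a \<Rightarrow> complex) \<Rightarrow> ('a set \<Rightarrow> complex)
      \<Rightarrow> 'a \<Rightarrow> complex" where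
  "fun_dot_measure G T f \<mu> y = complex_integral (borel_of T) \<mu> (\<lambda>x. f (x \<otimes>\<^bsub>G\<^esub> y))"

definition M_space ::
    "('a, 'b) monoid_scheme \<Rightarrow> 'a topology \<Rightarrow> ('a set \<Rightarrow> complex) set" where
  "M_space G T =
     {\<mu> \<in> complex_radon_measures T.
        \<forall>f \<in> bounded_continuous_functions T.
          fun_dot_measure G T f \<mu> \<in> bounded_continuous_functions T}"

definition M_sigma_space ::
    "('a, 'b) monoid_scheme \<Rightarrow> 'a topology \<Rightarrow> ('a set \<Rightarrow> complex) set" where
  "M_sigma_space G T =
     {\<mu> \<in> complex_radon_measures T.
        \<forall>f \<in> continuous_functions T.
          fun_dot_measure G T f \<mu> \<in> continuous_functions (sigma_topology G T)}"


section \<open>The measure $\lambda_H$\<close>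

text \<open>
  A compact Hausdorff topological group has exactly one right Haar probability measure (which is
  also left invariant), so the choice operator selects the normalized Haar measure of \<open>H\<close>.
\<close>

definition normalized_haar ::
    "('a, 'b) monoid_scheme \<Rightarrow> 'a topology \<Rightarrow> 'a set \<Rightarrow> 'a measure" where
  "normalized_haar G T H =
     (SOME N. right_haar_measure (G\<lparr>carrier := H\<rparr>) (subtopology T H) N)"

definition extend_measure_by_zero :: "'a measure \<Rightarrow> 'a set \<Rightarrow> complex" where
  "extend_measure_by_zero N E = complex_of_real (measure N (E \<inter> space N))"

definition lambda_sub ::
    "('a, 'b) monoid_scheme \<Rightarrow> 'a topology \<Rightarrow> 'a set \<Rightarrow> 'a set \<Rightarrow> complex" where
  "lambda_sub G T H = extend_measure_by_zero (normalized_haar G T H)"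

text \<open>
  As a functional, the extension by zero of a finite Borel measure \<open>N\<close> on a subspace \<open>H\<close> is
  integration of the restriction to \<open>H\<close> against \<open>N\<close>.
\<close>

lemma complex_integral_extend_measure_by_zero:
  assumes fin: "finite_measure N" and sets: "sets N = sets (borel_of (subtopology T H))"
    and H: "H \<subseteq> topspace T" and f: "continuous_map T euclidean (f :: 'a \<Rightarrow> complex)"
  shows "complex_integral (borel_of T) (extend_measure_by_zero N) f = integral\<^sup>L N f"
proof -
  interpret finite_measure N by (rule fin)
  have sp: "space N = H"
    using sets_eq_imp_space_eq[OF sets] H by (auto simp: space_borel_of)
  have id: "(\<lambda>x. x) \<in> measurable N (borel_of T)"
    unfolding borel_of_def
  proof (rule measurable_sigma_sets)
    show "sets (sigma (topspace T) {U. openin T U}) = sigma_sets (topspace T) {U. openin T U}"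
      using sets_borel_of by (simp add: borel_of_def)
    show "{U. openin T U} \<subseteq> Pow (topspace T)"
      by (auto dest: openin_subset)
    show "(\<lambda>x. x) \<in> space N \<rightarrow> topspace T"
      using sp H by auto
    fix U assume "U \<in> {U. openin T U}"
    then have "openin (subtopology T H) (U \<inter> H)"
      by (auto simp: openin_subtopology)
    then show "(\<lambda>x. x) -` U \<inter> space N \<in> sets N"
      by (auto simp: sp sets sets_borel_of)
  qed
  have int: "E \<inter> H \<in> sets N" if "E \<in> sets (borel_of T)" for E
    using measurable_sets[OF id that] by (simp add: sp)
  have fm: "f \<in> borel_measurable (borel_of T)"
  proof (rule borel_measurableI)
    fix S :: "complex set" assume "open S"
    then have "openin T {x \<in> topspace T. f x \<in> S}"
      using f by (auto simp: continuous_map_def)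
    moreover have "f -` S \<inter> space (borel_of T) = {x \<in> topspace T. f x \<in> S}"
      by (auto simp: space_borel_of)
    ultimately show "f -` S \<inter> space (borel_of T) \<in> sets (borel_of T)"
      by (auto simp: sets_borel_of)
  qed
  have alg: "sigma_sets (space (borel_of T)) (sets (borel_of T)) = sets (borel_of T)"
    by (rule sets.sigma_sets_eq)
  have pos: "positive_part (borel_of T) (\<lambda>E. Re (extend_measure_by_zero N E))
      = distr N (borel_of T) (\<lambda>x. x)"
    unfolding positive_part_def distr_def
  proof (rule measure_of_eq)
    show "sets (borel_of T) \<subseteq> Pow (space (borel_of T))"
      by (rule sets.space_closed)
    fix E assume "E \<in> sigma_sets (space (borel_of T)) (sets (borel_of T))"
    then have E: "E \<in> sets (borel_of T)" by (simp add: alg)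
    show "(SUP B\<in>{B \<in> sets (borel_of T). B \<subseteq> E}.
            ennreal (Re (extend_measure_by_zero N B))) = emeasure N ((\<lambda>x. x) -` E \<inter> space N)"
      (is "?sup = ?em")
    proof (rule antisym)
      have le: "emeasure N (B \<inter> H) \<le> emeasure N (E \<inter> H)" if "B \<subseteq> E" for B
        using that int[OF E] by (intro emeasure_mono) auto
      show "?sup \<le> ?em"
        by (rule SUP_least)
           (use le in \<open>simp add: extend_measure_by_zero_def sp flip: emeasure_eq_measure\<close>)
      show "?em \<le> ?sup"
        by (rule SUP_upper2[of E])
           (use E in \<open>simp_all add: extend_measure_by_zero_def sp flip: emeasure_eq_measure\<close>)
    qed
  qed
  have null: "integral\<^sup>L (positive_part (borel_of T) \<nu>) f = 0" if "\<And>E. \<nu> E \<le> 0" for \<nu>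
  proof -
    have "positive_part (borel_of T) \<nu> = null_measure (borel_of T)"
      unfolding positive_part_def null_measure_def
    proof (rule measure_of_eq)
      show "sets (borel_of T) \<subseteq> Pow (space (borel_of T))"
        by (rule sets.space_closed)
      fix E assume "E \<in> sigma_sets (space (borel_of T)) (sets (borel_of T))"
      show "(SUP B\<in>{B \<in> sets (borel_of T). B \<subseteq> E}. ennreal (\<nu> B)) = 0"
        using that by (auto simp: ennreal_neg intro!: antisym SUP_least)
    qed
    then show ?thesis by simp
  qed
  have "integral\<^sup>L (distr N (borel_of T) (\<lambda>x. x)) f = integral\<^sup>L N f"
    by (rule integral_distr[OF id fm])
  then show ?thesis
    unfolding complex_integral_def pos
    by (simp add: null extend_measure_by_zero_def)
qed

end

theory Submission
  imports Defs
begin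

text \<open>
  For bounded continuous \<open>f\<close> the function \<open>(x, y) \<mapsto> f (x \<otimes> y)\<close> on \<open>H \<times> G\<close> is separately continuous,
  because \<open>H\<close> lies in the topological center. Grothendieck's double limit argument together with
  dominated convergence shows that averaging it over the compact group \<open>H\<close> yields a continuous
  function of \<open>y\<close>.

  This average is constant on the cosets of \<open>H\<close>. If \<open>H\<close> is \<open>\<sigma>\<sigma>\<close>-closed, any two cosets are separated
  by \<open>H\<close>-invariant \<open>\<sigma>\<close>-open sets. As \<open>\<sigma>\<close> is coarser than \<open>\<tau>\<close>, compactness makes every \<open>H\<close>-invariant
  \<open>\<tau>\<close>-open set \<open>\<sigma>\<close>-open, so averages are \<open>\<sigma>\<close>-continuous. Moreover \<open>(x, y) \<mapsto> x\<inverse>y\<close> is by definition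
  jointly continuous from \<open>\<tau> \<times> \<tau>\<close> to \<open>\<sigma>\<close>, so the \<open>H\<close>-invariant \<open>\<tau>\<close>-open sets turn \<open>G\<close> into a
  compact topological group. Integrating averages over \<open>H\<close> against its Haar measure is a
  right-invariant functional on the continuous functions of \<open>G\<close>, and the Radon measure of that
  functional is a right Haar measure.
\<close>

section \<open>Radon measures from contents\<close>

text \<open>Dominated convergence speaks of sequences, while no point of \<open>G\<close> is assumed
  to have a countable neighbourhood base. A failure of continuity is therefore turned into a
  sequence, chosen together with finite nets so that its cluster points determine the pointwise
  limits. In \<open>G\<close> only right translations are continuous in general, so covering numbers
  cannot be used on \<open>(G, T)\<close> directly. Joint continuity appears only in the topology of
  \<open>H\<close>-invariant open sets. Its Borel sets are unions of cosets, too few for a measure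
  on \<open>T\<close>; averaging over \<open>H\<close> bridges that gap. Haar measure is thus built
  by covering numbers for two groups: \<open>H\<close>, and \<open>G\<close> with the coarser
  topology, which is not Hausdorff unless \<open>H\<close> is trivial. Hence closed sets of a
  compact normal space take the role of compact sets. One passage from a set function on closed sets
  to a Radon measure serves both Haar contents and the final functional. In the last case the set
  function is the infimum of the functional over nonnegative functions that are at least 1 on the
  closed set; invariance is read off from this infimum, with no integral representation of the
  functional in between.\<close>

lemma openin_sets_borel_of: "openin X U \<Longrightarrow> U \<in> sets (borel_of X)"
  by (auto simp: sets_borel_of)

lemma closedin_sets_borel_of: "closedin X K \<Longrightarrow> K \<in> sets (borel_of X)"
  using sets.compl_sets[OF openin_sets_borel_of[of X "topspace X - K"]]
  by (simp add: space_borel_of double_diff closedin_subset openin_diff)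

lemma continuous_map_measurable_borel_of:
  assumes "continuous_map X Y f"
  shows "f \<in> measurable (borel_of X) (borel_of Y)"
proof (rule measurable_sigma_sets[OF sets_borel_of])
  show "{U. openin Y U} \<subseteq> Pow (topspace Y)"
    by (auto dest: openin_subset)
  show "f \<in> space (borel_of X) \<rightarrow> topspace Y"
    using assms by (auto simp: space_borel_of continuous_map_def)
  fix U assume "U \<in> {U. openin Y U}"
  then have "openin X {x \<in> topspace X. f x \<in> U}"
    using assms by (auto simp: continuous_map_def)
  moreover have "f -` U \<inter> space (borel_of X) = {x \<in> topspace X. f x \<in> U}"
    by (auto simp: space_borel_of)
  ultimately show "f -` U \<inter> space (borel_of X) \<in> sets (borel_of X)"
    by (simp add: openin_sets_borel_of)
qed

lemma continuous_map_borel_measurable: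
  fixes f :: "'a \<Rightarrow> 'b::topological_space"
  assumes "continuous_map X euclidean f"
  shows "f \<in> borel_measurable (borel_of X)"
proof (rule borel_measurableI)
  fix S :: "'b set" assume "open S"
  then have "openin X {x \<in> topspace X. f x \<in> S}"
    using assms by (auto simp: continuous_map_def)
  moreover have "f -` S \<inter> space (borel_of X) = {x \<in> topspace X. f x \<in> S}"
    by (auto simp: space_borel_of)
  ultimately show "f -` S \<inter> space (borel_of X) \<in> sets (borel_of X)"
    by (simp add: openin_sets_borel_of)
qed

lemma homeomorphic_map_image_sets_borel_of:
  assumes "homeomorphic_map X X h" and E: "E \<in> sets (borel_of X)"
  shows "h ` E \<in> sets (borel_of X)"
proof -
  obtain h' where h': "homeomorphic_maps X X h h'"
    using assms(1) homeomorphic_map_maps by blast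
  then have "h' \<in> measurable (borel_of X) (borel_of X)"
    by (intro continuous_map_measurable_borel_of) (simp add: homeomorphic_maps_def)
  from measurable_sets[OF this E] have "h' -` E \<inter> topspace X \<in> sets (borel_of X)"
    by (simp add: space_borel_of)
  also have "h' -` E \<inter> topspace X = h ` E"
  proof -
    have "E \<subseteq> topspace X"
      using sets.sets_into_space[OF E] by (simp add: space_borel_of)
    then show ?thesis
      using h' by (auto simp: homeomorphic_maps_def continuous_map_def image_iff subset_iff) metis
  qed
  finally show ?thesis .
qed

lemma ennreal_add_less_self:
  fixes a b :: ennreal
  assumes "a < \<infinity>" "0 < b"
  shows "a < a + b"
  using assms ennreal_add_left_cancel_less[of a 0 b] by (simp add: less_top)

text \<open>A content in the sense of Halmos, on closed instead of compact sets: without the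
  Hausdorff axiom compact sets need not be closed or Borel, whereas here every closed set is
  compact.\<close>

locale closed_content =
  fixes X :: "'a topology" and c :: "'a set \<Rightarrow> real"
  assumes compact: "compact_space X" and normal: "normal_space X"
    and nonneg: "closedin X K \<Longrightarrow> 0 \<le> c K"
    and mono: "closedin X K \<Longrightarrow> closedin X L \<Longrightarrow> K \<subseteq> L \<Longrightarrow> c K \<le> c L"
    and subadd: "closedin X K \<Longrightarrow> closedin X L \<Longrightarrow> c (K \<union> L) \<le> c K + c L"
    and add: "closedin X K \<Longrightarrow> closedin X L \<Longrightarrow> disjnt K L \<Longrightarrow> c (K \<union> L) = c K + c L"
begin

section \<open>Radon measure of a content by Caratheodory's method\<close>

definition open_measure :: "'a set \<Rightarrow> ennreal" where
  "open_measure U = (SUP K \<in> {K. closedin X K \<and> K \<subseteq> U}. ennreal (c K))"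

definition outer :: "'a set \<Rightarrow> ennreal" where
  "outer E = (INF U \<in> {U. openin X U \<and> E \<subseteq> U}. open_measure U)"

lemma content_empty: "c {} = 0"
  using add[of "{}" "{}"] by simp

lemma content_le_open_measure: "closedin X K \<Longrightarrow> K \<subseteq> U \<Longrightarrow> ennreal (c K) \<le> open_measure U"
  unfolding open_measure_def by (rule SUP_upper) auto

lemma open_measure_least:
  "(\<And>K. closedin X K \<Longrightarrow> K \<subseteq> U \<Longrightarrow> ennreal (c K) \<le> b) \<Longrightarrow> open_measure U \<le> b"
  unfolding open_measure_def by (rule SUP_least) auto

lemma open_measure_mono: "U \<subseteq> V \<Longrightarrow> open_measure U \<le> open_measure V"
  by (rule open_measure_least) (auto intro: content_le_open_measure)

lemma open_measure_topspace: "open_measure (topspace X) = ennreal (c (topspace X))"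
proof (rule antisym)
  show "open_measure (topspace X) \<le> ennreal (c (topspace X))"
    by (rule open_measure_least) (auto intro!: ennreal_leI mono)
qed (rule content_le_open_measure; simp)

lemma open_measure_finite: "U \<subseteq> topspace X \<Longrightarrow> open_measure U < \<infinity>"
  using open_measure_mono[of U "topspace X"] open_measure_topspace
  by (simp add: le_less_trans)

text \<open>\<open>K - U\<close> and \<open>K - V\<close> are disjoint closed sets, so normality
  gives disjoint open sets around them; removing each of these from \<open>K\<close> leaves the two
  pieces. This is the only use of normality in the construction of the measure.\<close>

lemma closed_split:
  assumes K: "closedin X K" and U: "openin X U" and V: "openin X V" and sub: "K \<subseteq> U \<union> V"
  obtains K1 K2 where "closedin X K1" "closedin X K2" "K1 \<subseteq> U" "K2 \<subseteq> V" "K = K1 \<union> K2"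
proof -
  have "closedin X (K - U)" "closedin X (K - V)" "disjnt (K - U) (K - V)"
    using K U V sub by (auto simp: closedin_diff disjnt_def)
  then obtain A B where AB: "openin X A" "openin X B" "K - U \<subseteq> A" "K - V \<subseteq> B" "disjnt A B"
    using normal unfolding normal_space_def by meson
  show ?thesis
  proof (rule that)
    show "closedin X (K - A)" "closedin X (K - B)"
      using K AB by (auto intro: closedin_diff)
    show "K = (K - A) \<union> (K - B)"
      using AB by (auto simp: disjnt_def)
  qed (use AB in auto)
qed

lemma open_measure_Un:
  assumes U: "openin X U" and V: "openin X V"
  shows "open_measure (U \<union> V) \<le> open_measure U + open_measure V"
proof (rule open_measure_least)
  fix K assume K: "closedin X K" "K \<subseteq> U \<union> V"
  then obtain K1 K2 where s: "closedin X K1" "closedin X K2" "K1 \<subseteq> U" "K2 \<subseteq> V" "K = K1 \<union> K2"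
    using closed_split[OF K(1) U V K(2)] by metis
  have "ennreal (c K) \<le> ennreal (c K1 + c K2)"
    using s subadd by (auto intro: ennreal_leI)
  also have "\<dots> = ennreal (c K1) + ennreal (c K2)"
    using s nonneg by simp
  also have "\<dots> \<le> open_measure U + open_measure V"
    using s by (intro add_mono content_le_open_measure)
  finally show "ennreal (c K) \<le> open_measure U + open_measure V" .
qed

lemma open_measure_empty: "open_measure {} = 0"
  using open_measure_least[of "{}" 0] content_empty by auto

lemma open_measure_finite_UN:
  assumes "\<And>i. openin X (U i)"
  shows "open_measure (\<Union>i<n::nat. U i) \<le> (\<Sum>i<n. open_measure (U i))"
proof (induction n)
  case 0
  then show ?case by (simp add: open_measure_empty)
next
  case (Suc n)
  have "open_measure (\<Union>i<Suc n. U i) = open_measure ((\<Union>i<n. U i) \<union> U n)"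
    by (simp add: lessThan_Suc Un_commute)
  also have "\<dots> \<le> open_measure (\<Union>i<n. U i) + open_measure (U n)"
    using assms by (intro open_measure_Un) auto
  also have "\<dots> \<le> (\<Sum>i<n. open_measure (U i)) + open_measure (U n)"
    by (intro add_mono Suc.IH order_refl)
  finally show ?case by simp
qed

text \<open>Compactness turns finite subadditivity into countable subadditivity: a closed set inside
  the union already lies in a finite part of it.\<close>

lemma open_measure_UN:
  assumes U: "\<And>i::nat. openin X (U i)"
  shows "open_measure (\<Union>i. U i) \<le> (\<Sum>i. open_measure (U i))"
proof (rule open_measure_least)
  fix K assume K: "closedin X K" "K \<subseteq> (\<Union>i. U i)"
  have "compactin X K"
    by (rule closedin_compact_space[OF compact K(1)])
  then obtain F where F: "finite F" "F \<subseteq> range U" "K \<subseteq> \<Union>F"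
    using compactinD[of X K "range U"] K U by auto
  then obtain I where I: "finite I" "F = U ` I"
    by (meson finite_subset_image)
  then obtain n where "I \<subseteq> {..<n}"
    by (metis finite_nat_iff_bounded)
  then have "K \<subseteq> (\<Union>i<n. U i)"
    using F I by blast
  then have "ennreal (c K) \<le> open_measure (\<Union>i<n. U i)"
    using K by (intro content_le_open_measure)
  also have "\<dots> \<le> (\<Sum>i<n. open_measure (U i))"
    using U by (rule open_measure_finite_UN)
  also have "\<dots> \<le> (\<Sum>i. open_measure (U i))"
    by (rule sum_le_suminf) auto
  finally show "ennreal (c K) \<le> (\<Sum>i. open_measure (U i))" .
qed

lemma outer_le: "openin X U \<Longrightarrow> E \<subseteq> U \<Longrightarrow> outer E \<le> open_measure U"
  unfolding outer_def by (rule INF_lower) auto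

lemma outer_greatest:
  "(\<And>U. openin X U \<Longrightarrow> E \<subseteq> U \<Longrightarrow> b \<le> open_measure U) \<Longrightarrow> b \<le> outer E"
  unfolding outer_def by (rule INF_greatest) auto

lemma outer_open: "openin X U \<Longrightarrow> outer U = open_measure U"
  by (intro antisym outer_le outer_greatest open_measure_mono) auto

lemma outer_mono: "E \<subseteq> F \<Longrightarrow> outer E \<le> outer F"
  by (intro outer_greatest outer_le) auto

lemma outer_UN:
  assumes A: "\<And>i::nat. A i \<subseteq> topspace X"
  shows "outer (\<Union>i. A i) \<le> (\<Sum>i. outer (A i))"
proof (rule ennreal_le_epsilon)
  fix e :: real assume e: "0 < e"
  have "\<exists>U. openin X U \<and> A i \<subseteq> U \<and> open_measure U \<le> outer (A i) + ennreal (e * (1/2) ^ Suc i)" for i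
  proof -
    have "outer (A i) < \<infinity>"
      using outer_le[of "topspace X" "A i"] A[of i] open_measure_finite[of "topspace X"]
      by (simp add: le_less_trans)
    then have "outer (A i) < outer (A i) + ennreal (e * (1/2) ^ Suc i)"
      using e by (intro ennreal_add_less_self) auto
    then obtain U where "U \<in> {U. openin X U \<and> A i \<subseteq> U}"
      "open_measure U < outer (A i) + ennreal (e * (1/2) ^ Suc i)"
      using INF_less_iff[of open_measure "{U. openin X U \<and> A i \<subseteq> U}"] outer_def[of "A i"] by auto
    then show ?thesis by (auto intro: less_imp_le)
  qed
  then obtain U where U: "\<And>i. openin X (U i)" "\<And>i. A i \<subseteq> U i"
    "\<And>i. open_measure (U i) \<le> outer (A i) + ennreal (e * (1/2) ^ Suc i)"
    by metis
  have "outer (\<Union>i. A i) \<le> open_measure (\<Union>i. U i)"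
    using U by (intro outer_le) auto
  also have "\<dots> \<le> (\<Sum>i. open_measure (U i))"
    using U by (intro open_measure_UN)
  also have "\<dots> \<le> (\<Sum>i. outer (A i) + ennreal (e * (1/2) ^ Suc i))"
    using U by (intro suminf_le) auto
  also have "\<dots> = (\<Sum>i. outer (A i)) + (\<Sum>i. ennreal (e * (1/2) ^ Suc i))"
    by (rule suminf_add[symmetric]) auto
  also have "(\<Sum>i. ennreal (e * (1/2) ^ Suc i)) = ennreal e"
    using e sums_mult[OF power_half_series, of e]
    by (intro suminf_ennreal_eq) (auto simp del: power_Suc)
  finally show "outer (\<Union>i. A i) \<le> (\<Sum>i. outer (A i)) + ennreal e" .
qed

lemma outer_empty: "outer {} = 0"
  by (simp add: outer_open open_measure_empty)

lemma outer_measure_space_outer: "outer_measure_space (Pow (topspace X)) outer"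
  unfolding outer_measure_space_def positive_def increasing_def countably_subadditive_def
proof (intro conjI ballI allI impI)
  fix A :: "nat \<Rightarrow> 'a set" assume "range A \<subseteq> Pow (topspace X)"
  then show "outer (\<Union>i. A i) \<le> (\<Sum>i. outer (A i))"
    by (intro outer_UN) auto
qed (auto intro: outer_mono simp: outer_empty)

text \<open>Exhaust \<open>V \<inter> U\<close> by closed sets \<open>K\<close>, and for each
  \<open>K\<close> exhaust the open set \<open>V - K\<close>, which contains \<open>V - U\<close>,
  by closed sets \<open>L\<close>. Then \<open>K\<close> and \<open>L\<close> are disjoint inside
  \<open>V\<close>, and additivity of the content applies.\<close>

lemma outer_split_open:
  assumes U: "openin X U" and V: "openin X V"
  shows "outer (V \<inter> U) + outer (V - U) \<le> open_measure V"
proof -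
  have 1: "ennreal (c K) + outer (V - U) \<le> open_measure V"
    if K: "closedin X K" "K \<subseteq> V \<inter> U" for K
  proof -
    have "ennreal (c K) + outer (V - U) \<le> ennreal (c K) + open_measure (V - K)"
      using K V by (intro add_left_mono outer_le) (auto intro: openin_diff)
    also have "\<dots> = (SUP L\<in>{L. closedin X L \<and> L \<subseteq> V - K}. ennreal (c K) + ennreal (c L))"
      unfolding open_measure_def by (rule ennreal_SUP_add_right) auto
    also have "\<dots> \<le> open_measure V"
    proof (rule SUP_least)
      fix L assume "L \<in> {L. closedin X L \<and> L \<subseteq> V - K}"
      then have L: "closedin X L" "L \<subseteq> V - K" by auto
      have "ennreal (c K) + ennreal (c L) = ennreal (c (K \<union> L))"
        using K L nonneg by (subst add) (auto simp: disjnt_def)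
      also have "\<dots> \<le> open_measure V"
        using K L by (intro content_le_open_measure) auto
      finally show "ennreal (c K) + ennreal (c L) \<le> open_measure V" .
    qed
    finally show ?thesis .
  qed
  have "outer (V \<inter> U) + outer (V - U) = open_measure (V \<inter> U) + outer (V - U)"
    using U V by (simp add: outer_open openin_Int)
  also have "\<dots> = (SUP K\<in>{K. closedin X K \<and> K \<subseteq> V \<inter> U}. ennreal (c K) + outer (V - U))"
    unfolding open_measure_def by (rule ennreal_SUP_add_left[symmetric]) auto
  also have "\<dots> \<le> open_measure V"
    using 1 by (intro SUP_least) auto
  finally show ?thesis .
qed

text \<open>Caratheodory's condition for open sets. An arbitrary test set \<open>E\<close> reduces
  to an open one because \<open>outer E\<close> is an infimum over open supersets.\<close>

lemma outer_split:
  assumes U: "openin X U" and E: "E \<subseteq> topspace X"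
  shows "outer (U \<inter> E) + outer ((topspace X - U) \<inter> E) = outer E"
proof (rule antisym)
  show "outer (U \<inter> E) + outer ((topspace X - U) \<inter> E) \<le> outer E"
  proof (rule outer_greatest)
    fix V assume V: "openin X V" "E \<subseteq> V"
    have "outer (U \<inter> E) + outer ((topspace X - U) \<inter> E) \<le> outer (V \<inter> U) + outer (V - U)"
      using V by (intro add_mono outer_mono) auto
    then show "outer (U \<inter> E) + outer ((topspace X - U) \<inter> E) \<le> open_measure V"
      using outer_split_open[OF U V(1)] by (rule order_trans)
  qed
  interpret P: sigma_algebra "topspace X" "Pow (topspace X)"
    by (rule sigma_algebra_Pow)
  have "subadditive (Pow (topspace X)) outer"
    using outer_measure_space_outer
    by (intro P.countably_subadditive_subadditive) (auto simp: outer_measure_space_def)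
  then have "outer ((U \<inter> E) \<union> ((topspace X - U) \<inter> E))
      \<le> outer (U \<inter> E) + outer ((topspace X - U) \<inter> E)"
    using E by (intro subadditiveD) auto
  moreover have "(U \<inter> E) \<union> ((topspace X - U) \<inter> E) = E"
    using E by auto
  ultimately show "outer E \<le> outer (U \<inter> E) + outer ((topspace X - U) \<inter> E)"
    by simp
qed

lemma measure_space_outer: "measure_space (topspace X) (sets (borel_of X)) outer"
proof -
  interpret P: sigma_algebra "topspace X" "Pow (topspace X)"
    by (rule sigma_algebra_Pow)
  let ?L = "lambda_system (topspace X) (Pow (topspace X)) outer"
  have L: "measure_space (topspace X) ?L outer"
    by (rule P.caratheodory_lemma[OF outer_measure_space_outer])
  interpret L: sigma_algebra "topspace X" ?L
    using L by (simp add: measure_space_def)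
  have "{U. openin X U} \<subseteq> ?L"
    using outer_split by (auto simp: lambda_system_def dest: openin_subset)
  then have "sets (borel_of X) \<subseteq> ?L"
    unfolding sets_borel_of by (rule L.sigma_sets_subset)
  then show ?thesis
    using L sets.sigma_algebra_axioms[of "borel_of X"]
    by (auto simp: measure_space_def positive_def countably_additive_def space_borel_of)
qed

definition radon :: "'a measure" where
  "radon = measure_of (topspace X) (sets (borel_of X)) outer"

lemma sets_radon [simp]: "sets radon = sets (borel_of X)"
  and space_radon [simp]: "space radon = topspace X"
  unfolding radon_def using sets.space_closed[of "borel_of X"] sets.sigma_sets_eq[of "borel_of X"]
  by (simp_all add: space_borel_of sets_measure_of space_measure_of)

lemma emeasure_radon: "E \<in> sets (borel_of X) \<Longrightarrow> emeasure radon E = outer E"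
  unfolding radon_def using measure_space_outer
  by (intro emeasure_measure_of_sigma) (auto simp: measure_space_def)

lemma emeasure_radon_open: "openin X U \<Longrightarrow> emeasure radon U = open_measure U"
  by (simp add: emeasure_radon openin_sets_borel_of outer_open)

lemma finite_measure_radon: "finite_measure radon"
  by (rule finite_measureI) (simp add: emeasure_radon_open open_measure_topspace)

text \<open>Outer regularity holds by construction. Applied to the complement of \<open>E\<close> it
  gives an open set whose complement is a closed subset of \<open>E\<close>, and finiteness of the
  total mass transfers the estimate.\<close>

lemma inner_regular_radon:
  assumes E: "E \<in> sets (borel_of X)"
  shows "emeasure radon E = (SUP K \<in> {K. closedin X K \<and> K \<subseteq> E}. emeasure radon K)" (is "_ = ?s")
proof (rule antisym)
  interpret finite_measure radon by (rule finite_measure_radon)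
  let ?X = "topspace X"
  have E': "?X - E \<in> sets radon" and Esub: "E \<subseteq> ?X"
    using sets.compl_sets[OF E] sets.sets_into_space[OF E] by (auto simp: space_borel_of)
  show "emeasure radon E \<le> ?s"
  proof (rule ennreal_le_epsilon)
    fix e :: real assume e: "0 < e"
    have "outer (?X - E) < \<infinity>"
      using emeasure_finite[of "?X - E"] E'
      unfolding emeasure_radon[OF E'[unfolded sets_radon]] by (simp add: less_top[symmetric])
    then have "outer (?X - E) < outer (?X - E) + ennreal e"
      using e by (intro ennreal_add_less_self) auto
    then obtain U where U: "openin X U" "?X - E \<subseteq> U" "open_measure U < outer (?X - E) + ennreal e"
      using INF_less_iff[of open_measure "{U. openin X U \<and> ?X - E \<subseteq> U}"] outer_def[of "?X - E"]
      by auto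
    have Us: "U \<in> sets radon" "U \<subseteq> ?X"
      using openin_sets_borel_of[OF U(1)] openin_subset[OF U(1)] by auto
    have "measure radon U \<le> measure radon (?X - E) + e"
    proof -
      have "ennreal (measure radon U) \<le> ennreal (measure radon (?X - E) + e)"
        using U e E' by (simp add: emeasure_eq_measure[symmetric] emeasure_radon_open emeasure_radon)
      then show ?thesis using e by (simp add: ennreal_le_iff flip: ennreal_plus)
    qed
    moreover have "measure radon (?X - E) = measure radon ?X - measure radon E"
      using E finite_measure_compl[of E] by simp
    moreover have "measure radon (?X - U) = measure radon ?X - measure radon U"
      using Us finite_measure_compl[of U] by simp
    ultimately have "measure radon E \<le> measure radon (?X - U) + e"
      by linarith
    then have "emeasure radon E \<le> emeasure radon (?X - U) + ennreal e"
      using e by (simp add: emeasure_eq_measure ennreal_leI flip: ennreal_plus)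
    also have "emeasure radon (?X - U) \<le> ?s"
      using U Esub by (intro SUP_upper) auto
    finally show "emeasure radon E \<le> ?s + ennreal e"
      by (simp add: add_right_mono)
  qed
  show "?s \<le> emeasure radon E"
    using E by (intro SUP_least emeasure_mono) auto
qed

lemma inner_regular: "inner_regular X (emeasure radon)"
  unfolding inner_regular_def
proof (intro ballI antisym)
  fix E assume E: "E \<in> sets (borel_of X)"
  have "emeasure radon E = (SUP K \<in> {K. closedin X K \<and> K \<subseteq> E}. emeasure radon K)"
    by (rule inner_regular_radon[OF E])
  also have "\<dots> \<le> (SUP K \<in> {K. compactin X K \<and> K \<subseteq> E}. emeasure radon K)"
    by (rule SUP_subset_mono) (auto intro: closedin_compact_space[OF compact])
  finally show "emeasure radon E \<le> (SUP K \<in> {K. compactin X K \<and> K \<subseteq> E}. emeasure radon K)" .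
  \<comment> \<open>A compact \<open>K\<close> need not be Borel here; \<open>emeasure_mono\<close>
    only asks that the larger set \<open>E\<close> be measurable.\<close>
  show "(SUP K \<in> {K. compactin X K \<and> K \<subseteq> E}. emeasure radon K) \<le> emeasure radon E"
    using E by (intro SUP_least emeasure_mono) auto
qed

lemma radon_probability:
  assumes "c (topspace X) = 1"
  shows "radon_probability X radon"
  unfolding radon_probability_def using inner_regular assms
  by (auto intro!: prob_spaceI simp: emeasure_radon_open open_measure_topspace)

text \<open>Both \<open>h\<close> and its inverse permute closed sets and open sets, so invariance
  of \<open>c\<close> passes to the supremum in \<open>open_measure\<close> and then to the infimum
  in \<open>outer\<close>.\<close>

lemma emeasure_radon_homeomorphic_image:
  assumes hom: "homeomorphic_map X X h" and inv: "\<And>K. closedin X K \<Longrightarrow> c (h ` K) = c K"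
    and E: "E \<in> sets (borel_of X)"
  shows "emeasure radon (h ` E) = emeasure radon E"
proof -
  obtain h' where h': "homeomorphic_maps X X h h'"
    using hom homeomorphic_map_maps by blast
  have hom': "homeomorphic_map X X h'"
    using h' homeomorphic_maps_map by blast
  have hh': "h (h' x) = x" "h' (h x) = x" "h x \<in> topspace X" "h' x \<in> topspace X" if "x \<in> topspace X" for x
    using h' that unfolding homeomorphic_maps_def by (auto simp: continuous_map_def)
  have h'h: "h ` h' ` A = A" "h' ` h ` A = A" if "A \<subseteq> topspace X" for A
    using that hh'(1,2) by (simp_all add: image_image subset_iff)
  have op: "open_measure (h ` U) = open_measure U" if U: "U \<subseteq> topspace X" for U
  proof (rule antisym)
    show "open_measure (h ` U) \<le> open_measure U"
    proof (rule open_measure_least)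
      fix K assume K: "closedin X K" "K \<subseteq> h ` U"
      have "closedin X (h' ` K)"
        using K closedin_subset[OF K(1)] homeomorphic_map_closedness[OF hom'] by simp
      moreover have "h' ` K \<subseteq> U"
        using K U h'h(2)[OF U] by blast
      moreover have "c K = c (h' ` K)"
        using inv[OF calculation(1)] h'h(1)[of K] K closedin_subset by fastforce
      ultimately show "ennreal (c K) \<le> open_measure U"
        by (simp add: content_le_open_measure)
    qed
    show "open_measure U \<le> open_measure (h ` U)"
    proof (rule open_measure_least)
      fix K assume K: "closedin X K" "K \<subseteq> U"
      have "closedin X (h ` K)"
        using K closedin_subset[OF K(1)] homeomorphic_map_closedness[OF hom] by simp
      then show "ennreal (c K) \<le> open_measure (h ` U)"
        using K inv[OF K(1)] content_le_open_measure[of "h ` K" "h ` U"] by auto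
    qed
  qed
  have Esub: "E \<subseteq> topspace X"
    using sets.sets_into_space[OF E] by (simp add: space_borel_of)
  have "outer (h ` E) = outer E"
  proof (rule antisym)
    show "outer (h ` E) \<le> outer E"
    proof (rule outer_greatest)
      fix U assume U: "openin X U" "E \<subseteq> U"
      have "openin X (h ` U)"
        using U openin_subset[OF U(1)] homeomorphic_map_openness[OF hom] by simp
      then show "outer (h ` E) \<le> open_measure U"
        using U op[of U] openin_subset[OF U(1)] outer_le[of "h ` U" "h ` E"] by auto
    qed
    show "outer E \<le> outer (h ` E)"
    proof (rule outer_greatest)
      fix U assume U: "openin X U" "h ` E \<subseteq> U"
      have U': "openin X (h' ` U)"
        using U openin_subset[OF U(1)] homeomorphic_map_openness[OF hom'] by simp
      moreover have "E \<subseteq> h' ` U"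
        using U Esub h'h(2)[OF Esub] by blast
      ultimately have "outer E \<le> open_measure (h' ` U)"
        by (rule outer_le)
      then show "outer E \<le> open_measure U"
        using op[OF openin_subset[OF U']] h'h(1)[OF openin_subset[OF U(1)]] by simp
    qed
  qed
  moreover have "h ` E \<in> sets (borel_of X)"
    by (rule homeomorphic_map_image_sets_borel_of[OF hom E])
  ultimately show ?thesis
    using E by (simp add: emeasure_radon)
qed

end

text \<open>The set function of the Riesz representation theorem. Taking the infimum over functions
  that dominate the indicator of \<open>K\<close> makes additivity and positivity of
  \<open>J\<close> enough for a content.\<close>

lemma closed_content_functional:
  fixes J :: "('a \<Rightarrow> real) \<Rightarrow> real"
  assumes X: "compact_space X" "normal_space X"
    and add: "\<And>f g. continuous_map X euclidean f \<Longrightarrow> continuous_map X euclidean g \<Longrightarrow>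
      J (\<lambda>x. f x + g x) = J f + J g"
    and nonneg: "\<And>f. continuous_map X euclidean f \<Longrightarrow> (\<And>x. x \<in> topspace X \<Longrightarrow> 0 \<le> f x) \<Longrightarrow> 0 \<le> J f"
  defines "M \<equiv> \<lambda>K. {f. continuous_map X euclidean f \<and> (\<forall>x\<in>topspace X. 0 \<le> f x) \<and> (\<forall>x\<in>K. 1 \<le> f x)}"
  shows "closed_content X (\<lambda>K. INF f\<in>M K. J f)"
    and "(INF f\<in>M (topspace X). J f) = J (\<lambda>_. 1)"
proof -
  have one: "(\<lambda>_. 1) \<in> M K" for K
    by (simp add: M_def)
  then have ne: "M K \<noteq> {}" for K
    by blast
  have bdd: "bdd_below (J ` M K)" for K
    by (rule bdd_belowI[of _ 0]) (auto simp: M_def intro: nonneg)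
  have J_mono: "J f \<le> J g" if f: "continuous_map X euclidean f" and g: "continuous_map X euclidean g"
    and fg: "\<And>x. x \<in> topspace X \<Longrightarrow> f x \<le> g x" for f g
  proof -
    have d: "continuous_map X euclidean (\<lambda>x. g x - f x)"
      by (intro continuous_map_diff f g)
    have "J g = J (\<lambda>x. f x + (g x - f x))" by simp
    also have "\<dots> = J f + J (\<lambda>x. g x - f x)"
      by (rule add[OF f d])
    finally show ?thesis
      using nonneg[OF d] fg by simp
  qed
  have le: "(INF f\<in>M K. J f) \<le> J f" if "f \<in> M K" for f K
    by (rule cINF_lower[OF bdd that])
  show "closed_content X (\<lambda>K. INF f\<in>M K. J f)"
  proof
    show "compact_space X" "normal_space X" by (rule X)+
    fix K L assume K: "closedin X K" and L: "closedin X L"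
    show "0 \<le> (INF f\<in>M K. J f)"
      by (rule cINF_greatest[OF ne]) (auto simp: M_def intro: nonneg)
    show "(INF f\<in>M K. J f) \<le> (INF f\<in>M L. J f)" if "K \<subseteq> L"
      by (rule cINF_superset_mono[OF ne bdd]) (use that in \<open>auto simp: M_def\<close>)
    show sub: "(INF f\<in>M (K \<union> L). J f) \<le> (INF f\<in>M K. J f) + (INF f\<in>M L. J f)"
    proof -
      \<comment> \<open>Fixing \<open>g\<close> allows the two infima to be taken one after the
        other: over \<open>f\<close> here, over \<open>g\<close> afterwards.\<close>
      have "(INF f\<in>M (K \<union> L). J f) - J g \<le> (INF f\<in>M K. J f)" if g: "g \<in> M L" for g
      proof (rule cINF_greatest[OF ne])
        fix f assume f: "f \<in> M K"
        have "1 \<le> f x + g x" if "x \<in> K \<union> L" for x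
          using that f g subsetD[OF closedin_subset[OF K], of x] subsetD[OF closedin_subset[OF L], of x]
          by (auto simp: M_def intro: add_increasing add_increasing2)
        then have "(\<lambda>x. f x + g x) \<in> M (K \<union> L)"
          using f g by (auto simp: M_def intro: continuous_map_add)
        then show "(INF f\<in>M (K \<union> L). J f) - J g \<le> J f"
          using le[of "\<lambda>x. f x + g x" "K \<union> L"] add[of f g] f g by (simp add: M_def)
      qed
      then have "(INF f\<in>M (K \<union> L). J f) - (INF f\<in>M K. J f) \<le> (INF f\<in>M L. J f)"
        by (intro cINF_greatest[OF ne]) (simp add: algebra_simps)
      then show ?thesis by simp
    qed
    show "(INF f\<in>M (K \<union> L). J f) = (INF f\<in>M K. J f) + (INF f\<in>M L. J f)" if KL: "disjnt K L"
    proof (rule antisym[OF sub], rule cINF_greatest[OF ne])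
      fix f assume f: "f \<in> M (K \<union> L)"
      \<comment> \<open>The Urysohn function splits \<open>f\<close> into
        \<open>f * (1 - u)\<close>, which equals \<open>f\<close> on \<open>K\<close>, and
        \<open>f * u\<close>, which equals \<open>f\<close> on \<open>L\<close>. The parts are
        admissible for \<open>K\<close> and \<open>L\<close>, and their sum is
        \<open>f\<close>.\<close>
      obtain u :: "'a \<Rightarrow> real" where u: "continuous_map X (top_of_set {0..1}) u" "u ` K \<subseteq> {0}" "u ` L \<subseteq> {1}"
        using X(2)[unfolded normal_space_iff_Urysohn, rule_format, OF conjI[OF K conjI[OF L KL]]]
        by (elim exE conjE)
      then have uc: "continuous_map X euclidean u" and u01: "\<And>x. x \<in> topspace X \<Longrightarrow> 0 \<le> u x \<and> u x \<le> 1"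
        by (auto simp: continuous_map_in_subtopology image_subset_iff)
      have fc: "continuous_map X euclidean f"
        using f by (simp add: M_def)
      have c: "continuous_map X euclidean (\<lambda>x. f x * (1 - u x))" "continuous_map X euclidean (\<lambda>x. f x * u x)"
        by (intro continuous_map_real_mult continuous_map_diff fc uc continuous_map_const[THEN iffD2]; simp)+
      have "(\<lambda>x. f x * (1 - u x)) \<in> M K" "(\<lambda>x. f x * u x) \<in> M L"
        using f u u01 c by (auto simp: M_def image_subset_iff)
      then have "(INF f\<in>M K. J f) + (INF f\<in>M L. J f) \<le> J (\<lambda>x. f x * (1 - u x)) + J (\<lambda>x. f x * u x)"
        by (intro add_mono le)
      also have "\<dots> = J (\<lambda>x. f x * (1 - u x) + f x * u x)"
        by (rule add[OF c, symmetric])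
      also have "\<dots> = J f"
        by (simp add: algebra_simps)
      finally show "(INF f\<in>M K. J f) + (INF f\<in>M L. J f) \<le> J f" .
    qed
  qed
  show "(INF f\<in>M (topspace X). J f) = J (\<lambda>_. 1)"
  proof (rule antisym[OF le[OF one]])
    show "J (\<lambda>_. 1) \<le> (INF f\<in>M (topspace X). J f)"
      by (rule cINF_greatest[OF ne]) (auto simp: M_def intro!: J_mono)
  qed
qed


section \<open>Haar measure of a compact group\<close>

context right_topological_group
begin

lemma openin_subset_carrier: "openin T U \<Longrightarrow> U \<subseteq> carrier G"
  using openin_subset topspace_eq by blast

lemma closedin_subset_carrier: "closedin T U \<Longrightarrow> U \<subseteq> carrier G"
  using closedin_subset topspace_eq by blast

lemma r_coset_image: "A #> x = (\<lambda>g. g \<otimes> x) ` A"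
  by (auto simp: r_coset_def)

lemma homeomorphic_right_translation:
  assumes x: "x \<in> carrier G"
  shows "homeomorphic_map T T (\<lambda>g. g \<otimes> x)"
proof -
  have "homeomorphic_maps T T (\<lambda>g. g \<otimes> x) (\<lambda>g. g \<otimes> inv x)"
    using x by (auto simp: homeomorphic_maps_def continuous_right_translation topspace_eq m_assoc)
  then show ?thesis
    using homeomorphic_maps_map by blast
qed

lemma openin_r_coset: "openin T U \<Longrightarrow> x \<in> carrier G \<Longrightarrow> openin T (U #> x)"
  unfolding r_coset_image
  using homeomorphic_map_openness[OF homeomorphic_right_translation] openin_subset by metis

text \<open>The common last step for the Haar content of a compact group and for the content that
  comes from averages over \<open>H\<close>.\<close>

lemma right_haar_measure_radon:
  assumes "closed_content T c" "c (carrier G) = 1"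
    and "\<And>K g. closedin T K \<Longrightarrow> g \<in> carrier G \<Longrightarrow> c (K #> g) = c K"
  shows "right_haar_measure G T (closed_content.radon T c)"
proof -
  interpret closed_content T c by fact
  show ?thesis
    unfolding right_haar_measure_def
    using assms(2,3) radon_probability
      emeasure_radon_homeomorphic_image[OF homeomorphic_right_translation]
    by (auto simp: topspace_eq r_coset_image)
qed

end

context topological_group
begin

sublocale right_topological_group
proof
  show "topspace T = carrier G" by (rule topspace_eq)
  fix x assume "x \<in> carrier G"
  then have "continuous_map T (prod_topology T T) (\<lambda>g. (g, x))"
    by (intro continuous_map_pairedI) (auto simp: topspace_eq)
  from continuous_map_compose[OF this continuous_mult]
  show "continuous_map T T (\<lambda>g. g \<otimes> x)"
    by (simp add: o_def)
qed

lemma continuous_map_mult: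
  assumes "continuous_map X T f" "continuous_map X T g"
  shows "continuous_map X T (\<lambda>x. f x \<otimes> g x)"
  using continuous_map_compose[OF continuous_map_pairedI[OF assms] continuous_mult]
  by (simp add: o_def)

lemma continuous_map_inv:
  assumes "continuous_map X T f"
  shows "continuous_map X T (\<lambda>x. inv (f x))"
  using continuous_map_compose[OF assms continuous_inv] by (simp add: o_def)

text \<open>Joint continuity of \<open>(u, v, y) \<mapsto> u v^-1 y\<close> at
  \<open>(\<one>, \<one>, x)\<close>, where its value is \<open>x\<close>. The shape is dictated by
  its use: \<open>u v^-1\<close> carries \<open>v \<otimes> a\<close> to
  \<open>u \<otimes> a\<close>, so it compares two points of one translate
  \<open>U #> a\<close>.\<close>

lemma nbhd_quotient_mult:
  assumes W: "openin T W" and x: "x \<in> W"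
  obtains N M where "openin T N" "\<one> \<in> N" "openin T M" "x \<in> M"
    "\<And>u v y. u \<in> N \<Longrightarrow> v \<in> N \<Longrightarrow> y \<in> M \<Longrightarrow> (u \<otimes> inv v) \<otimes> y \<in> W"
proof -
  let ?P = "prod_topology (prod_topology T T) T"
  have xG: "x \<in> carrier G"
    using W x openin_subset_carrier by blast
  have fs: "continuous_map ?P (prod_topology T T) fst" "continuous_map ?P T snd"
    by (rule continuous_map_fst continuous_map_snd)+
  have 1: "continuous_map ?P T (\<lambda>p. fst (fst p))" "continuous_map ?P T (\<lambda>p. snd (fst p))"
    using continuous_map_compose[OF fs(1) continuous_map_fst]
      continuous_map_compose[OF fs(1) continuous_map_snd] by (simp_all add: o_def)
  have "continuous_map ?P T (\<lambda>p. (fst (fst p) \<otimes> inv (snd (fst p))) \<otimes> snd p)"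
    by (intro continuous_map_mult continuous_map_inv 1 fs)
  then have O: "openin ?P {p \<in> topspace ?P. (fst (fst p) \<otimes> inv (snd (fst p))) \<otimes> snd p \<in> W}" (is "openin _ ?O")
    using W by (rule openin_continuous_map_preimage)
  have "((\<one>, \<one>), x) \<in> ?O"
    using x xG by (simp add: topspace_eq)
  then obtain A M where A: "openin (prod_topology T T) A" "(\<one>, \<one>) \<in> A"
    and M: "openin T M" "x \<in> M" and AM: "A \<times> M \<subseteq> ?O"
    using O unfolding openin_prod_topology_alt by meson
  obtain N1 N2 where N: "openin T N1" "openin T N2" "\<one> \<in> N1" "\<one> \<in> N2" "N1 \<times> N2 \<subseteq> A"
    using A unfolding openin_prod_topology_alt by meson
  show ?thesis
  proof (rule that[of "N1 \<inter> N2" M])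
    fix u v y assume "u \<in> N1 \<inter> N2" "v \<in> N1 \<inter> N2" "y \<in> M"
    then have "((u, v), y) \<in> ?O"
      using N AM by blast
    then show "(u \<otimes> inv v) \<otimes> y \<in> W" by simp
  qed (use N M in \<open>auto intro: openin_Int\<close>)
qed

end

text \<open>Normality takes the place of the Hausdorff axiom: the construction is also applied to the
  topology of \<open>H\<close>-invariant open sets, which does not separate the points of a coset.\<close>

locale compact_group = topological_group +
  assumes compact: "compact_space T" and normal: "normal_space T"
begin

section \<open>Haar's covering numbers\<close>

definition covers :: "'a set \<Rightarrow> 'a set \<Rightarrow> 'a set \<Rightarrow> bool" where
  "covers U A F \<longleftrightarrow> finite F \<and> F \<subseteq> carrier G \<and> A \<subseteq> (\<Union>a\<in>F. U #> a)"

text \<open>Haar's index \<open>(A : U)\<close>. Since the covering sets are right translates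
  \<open>U #> a\<close>, translating \<open>A\<close> on the right by \<open>g\<close> only moves
  the centres from \<open>a\<close> to \<open>a \<otimes> g\<close>; this is the source of right
  invariance.\<close>

definition cov :: "'a set \<Rightarrow> 'a set \<Rightarrow> nat" where
  "cov U A = (LEAST n. \<exists>F. covers U A F \<and> card F = n)"

definition nbhds_one :: "'a set set" where
  "nbhds_one = {U. openin T U \<and> \<one> \<in> U}"

lemma ex_covers:
  assumes U: "U \<in> nbhds_one" and A: "A \<subseteq> carrier G"
  shows "\<exists>F. covers U A F"
proof -
  have "carrier G \<subseteq> \<Union>((\<lambda>a. U #> a) ` carrier G)"
  proof
    fix x assume x: "x \<in> carrier G"
    then have "x \<in> U #> x"
      using U by (auto simp: nbhds_one_def r_coset_def intro!: bexI[of _ \<one>])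
    then show "x \<in> \<Union>((\<lambda>a. U #> a) ` carrier G)"
      using x by blast
  qed
  moreover have "openin T W" if "W \<in> (\<lambda>a. U #> a) ` carrier G" for W
    using that U by (auto simp: nbhds_one_def openin_r_coset)
  moreover have "compactin T (carrier G)"
    using compact by (simp add: compact_space_def topspace_eq)
  ultimately obtain \<F> where "finite \<F>" "\<F> \<subseteq> (\<lambda>a. U #> a) ` carrier G" "carrier G \<subseteq> \<Union>\<F>"
    using compactinD[of T "carrier G" "(\<lambda>a. U #> a) ` carrier G"] by metis
  moreover then obtain F where "finite F" "F \<subseteq> carrier G" "\<F> = (\<lambda>a. U #> a) ` F"
    by (meson finite_subset_image)
  ultimately show ?thesis
    using A unfolding covers_def by (intro exI[of _ F]) auto
qed

lemma cov_le: "covers U A F \<Longrightarrow> cov U A \<le> card F"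
  unfolding cov_def by (rule Least_le) blast

lemma cov_attained:
  assumes "U \<in> nbhds_one" "A \<subseteq> carrier G"
  obtains F where "covers U A F" "card F = cov U A"
proof -
  have "\<exists>n F. covers U A F \<and> card F = n"
    using ex_covers[OF assms] by blast
  then have "\<exists>F. covers U A F \<and> card F = cov U A"
    unfolding cov_def by (rule LeastI_ex)
  then show ?thesis using that by blast
qed

lemma cov_mono:
  assumes "U \<in> nbhds_one" "B \<subseteq> carrier G" "A \<subseteq> B"
  shows "cov U A \<le> cov U B"
proof -
  obtain F where F: "covers U B F" "card F = cov U B"
    using cov_attained[OF assms(1,2)] .
  then have "covers U A F"
    using assms(3) by (auto simp: covers_def)
  then show ?thesis using F cov_le by metis
qed

lemma cov_Un:
  assumes "U \<in> nbhds_one" "A \<subseteq> carrier G" "B \<subseteq> carrier G"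
  shows "cov U (A \<union> B) \<le> cov U A + cov U B"
proof -
  obtain F where F: "covers U A F" "card F = cov U A"
    using cov_attained[OF assms(1,2)] .
  obtain H where H: "covers U B H" "card H = cov U B"
    using cov_attained[OF assms(1,3)] .
  have "covers U (A \<union> B) (F \<union> H)"
    using F H by (auto simp: covers_def)
  then have "cov U (A \<union> B) \<le> card (F \<union> H)"
    by (rule cov_le)
  also have "\<dots> \<le> cov U A + cov U B"
    using card_Un_le[of F H] F H by simp
  finally show ?thesis .
qed

lemma cov_translate_le:
  assumes U: "U \<in> nbhds_one" and A: "A \<subseteq> carrier G" and g: "g \<in> carrier G"
  shows "cov U (A #> g) \<le> cov U A"
proof -
  obtain F where F: "covers U A F" "card F = cov U A"
    using cov_attained[OF U A] .
  have Us: "U \<subseteq> carrier G"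
    using U openin_subset_carrier by (auto simp: nbhds_one_def)
  have "covers U (A #> g) ((\<lambda>a. a \<otimes> g) ` F)"
    unfolding covers_def
  proof (intro conjI subsetI)
    show "finite ((\<lambda>a. a \<otimes> g) ` F)"
      using F by (auto simp: covers_def)
    show "x \<in> carrier G" if "x \<in> (\<lambda>a. a \<otimes> g) ` F" for x
      using that F g by (auto simp: covers_def)
    fix x assume "x \<in> A #> g"
    then obtain u a where "u \<in> U" "a \<in> F" "x = u \<otimes> a \<otimes> g"
      using F by (force simp: covers_def r_coset_def)
    moreover have "u \<otimes> a \<otimes> g = u \<otimes> (a \<otimes> g)"
      using calculation Us F g by (intro m_assoc) (auto simp: covers_def)
    ultimately show "x \<in> (\<Union>a\<in>(\<lambda>a. a \<otimes> g) ` F. U #> a)"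
      by (auto simp: r_coset_def)
  qed
  then have "cov U (A #> g) \<le> card ((\<lambda>a. a \<otimes> g) ` F)"
    by (rule cov_le)
  also have "\<dots> \<le> cov U A"
    using F by (metis card_image_le covers_def)
  finally show ?thesis .
qed

lemma cov_translate:
  assumes U: "U \<in> nbhds_one" and A: "A \<subseteq> carrier G" and g: "g \<in> carrier G"
  shows "cov U (A #> g) = cov U A"
proof (rule antisym)
  have "A #> g #> inv g = A"
    using A g by (simp add: coset_mult_assoc)
  then show "cov U A \<le> cov U (A #> g)"
    using cov_translate_le[OF U r_coset_subset_G[OF A g], of "inv g"] g by simp
qed (rule cov_translate_le[OF assms])

text \<open>In an optimal cover of \<open>A \<union> B\<close> no translate serves both sets, so the
  translates that meet \<open>A\<close> and those that meet \<open>B\<close> form disjoint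
  subfamilies, each covering its own set.\<close>

lemma cov_disjoint:
  assumes U: "U \<in> nbhds_one" and AB: "A \<subseteq> carrier G" "B \<subseteq> carrier G"
    and sep: "\<And>a. a \<in> carrier G \<Longrightarrow> (U #> a) \<inter> A = {} \<or> (U #> a) \<inter> B = {}"
  shows "cov U A + cov U B \<le> cov U (A \<union> B)"
proof -
  obtain F where F: "covers U (A \<union> B) F" "card F = cov U (A \<union> B)"
    using cov_attained[OF U Un_least[OF AB]] .
  let ?FA = "{a \<in> F. (U #> a) \<inter> A \<noteq> {}}" and ?FB = "{a \<in> F. (U #> a) \<inter> B \<noteq> {}}"
  have fin: "finite F" "F \<subseteq> carrier G"
    using F by (auto simp: covers_def)
  have "covers U C {a \<in> F. (U #> a) \<inter> C \<noteq> {}}" if "C \<subseteq> A \<union> B" for C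
    unfolding covers_def
  proof (intro conjI subsetI)
    fix x assume x: "x \<in> C"
    then obtain a where "a \<in> F" "x \<in> U #> a"
      using F \<open>C \<subseteq> A \<union> B\<close> unfolding covers_def by blast
    then show "x \<in> (\<Union>a\<in>{a \<in> F. (U #> a) \<inter> C \<noteq> {}}. U #> a)"
      using x by blast
  qed (use fin in auto)
  then have "covers U A ?FA" "covers U B ?FB"
    by simp_all
  then have "cov U A + cov U B \<le> card ?FA + card ?FB"
    by (intro add_mono cov_le)
  also have "\<dots> = card (?FA \<union> ?FB)"
    using fin sep by (intro card_Un_disjoint[symmetric]) auto
  also have "\<dots> \<le> card F"
    using fin by (intro card_mono) auto
  finally show ?thesis using F by simp
qed

lemma cov_carrier_pos:
  assumes U: "U \<in> nbhds_one"
  shows "0 < cov U (carrier G)"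
proof -
  obtain F where F: "covers U (carrier G) F" "card F = cov U (carrier G)"
    using cov_attained[OF U] by blast
  have "F \<noteq> {}"
    using F by (auto simp: covers_def)
  then show ?thesis
    using F by (metis card_gt_0_iff covers_def)
qed

text \<open>A translate of a small neighbourhood cannot meet both of two disjoint closed sets, which is why
  the limit of the relative covering numbers is additive.\<close>

lemma separating_nbhd:
  assumes A: "closedin T A" and B: "closedin T B" and AB: "disjnt A B"
  obtains V where "V \<in> nbhds_one"
    "\<And>U a. U \<subseteq> V \<Longrightarrow> a \<in> carrier G \<Longrightarrow> (U #> a) \<inter> A = {} \<or> (U #> a) \<inter> B = {}"
proof -
  have W: "openin T (carrier G - B)"
    using B topspace_eq by (metis openin_diff openin_topspace)
  have "\<exists>N M. openin T N \<and> \<one> \<in> N \<and> openin T M \<and> x \<in> M \<and>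
      (\<forall>u\<in>N. \<forall>v\<in>N. \<forall>y\<in>M. (u \<otimes> inv v) \<otimes> y \<in> carrier G - B)" (is "\<exists>N M. ?P x N M")
    if "x \<in> A" for x
  proof -
    have "x \<in> carrier G - B"
      using that A AB closedin_subset_carrier by (auto simp: disjnt_def)
    then show ?thesis
      using nbhd_quotient_mult[OF W] by metis
  qed
  then obtain N M where P: "\<And>x. x \<in> A \<Longrightarrow> ?P x (N x) (M x)"
    by metis
  have NM: "openin T (N x)" "\<one> \<in> N x" "openin T (M x)" "x \<in> M x" if "x \<in> A" for x
    using P[OF that] by simp_all
  have in_W: "(u \<otimes> inv v) \<otimes> y \<in> carrier G - B"
    if "x \<in> A" "u \<in> N x" "v \<in> N x" "y \<in> M x" for x u v y
    using P[OF that(1)] that by simp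
  have "compactin T A"
    by (rule closedin_compact_space[OF compact A])
  then have "\<exists>\<F>. finite \<F> \<and> \<F> \<subseteq> M ` A \<and> A \<subseteq> \<Union>\<F>"
    by (rule compactinD) (use NM in auto)
  then obtain \<F> where "finite \<F>" "\<F> \<subseteq> M ` A" "A \<subseteq> \<Union>\<F>"
    by metis
  moreover then obtain F where "finite F" "F \<subseteq> A" "\<F> = M ` F"
    by (meson finite_subset_image)
  ultimately have F: "finite F" "F \<subseteq> A" "A \<subseteq> (\<Union>x\<in>F. M x)"
    by auto
  \<comment> \<open>The factor \<open>carrier G\<close> keeps \<open>?V\<close> an open
    neighbourhood of \<open>\<one>\<close> when \<open>F\<close> is empty, which happens exactly for
    \<open>A = {}\<close>.\<close>
  let ?V = "carrier G \<inter> (\<Inter>x\<in>F. N x)"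
  show ?thesis
  proof (rule that[of ?V])
    have "openin T (\<Inter>x\<in>F. N x)" if "F \<noteq> {}"
      using that F NM by (intro openin_INT2) auto
    then have "openin T ?V"
      using openin_topspace[of T] topspace_eq by (cases "F = {}") (auto intro: openin_Int)
    then show "?V \<in> nbhds_one"
      using F NM by (auto simp: nbhds_one_def)
    fix U a assume U: "U \<subseteq> ?V" and a: "a \<in> carrier G"
    show "(U #> a) \<inter> A = {} \<or> (U #> a) \<inter> B = {}"
    proof (rule ccontr)
      assume "\<not> ?thesis"
      then obtain u v where uv: "u \<in> U" "v \<in> U" "v \<otimes> a \<in> A" "u \<otimes> a \<in> B"
        by (auto simp: r_coset_def)
      then obtain x where x: "x \<in> F" "v \<otimes> a \<in> M x"
        using F by blast
      have G: "u \<in> carrier G" "v \<in> carrier G"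
        using uv U by auto
      \<comment> \<open>A translate meeting both sets would put \<open>u \<otimes> a\<close> in
        \<open>B\<close>, yet this point arises from \<open>v \<otimes> a\<close> in
        \<open>M x\<close> by the small displacement \<open>u \<otimes> inv v\<close>, which stays
        off \<open>B\<close>.\<close>
      have "(u \<otimes> inv v) \<otimes> (v \<otimes> a) \<in> carrier G - B"
        using x uv U F by (intro in_W[of x]) auto
      also have "(u \<otimes> inv v) \<otimes> (v \<otimes> a) = u \<otimes> a"
        using G a by (simp add: m_assoc inv_solve_left flip: m_assoc[of "inv v"])
      finally show False using uv by simp
    qed
  qed
qed

text \<open>The default 0 outside the subsets of the carrier makes \<open>rel_cov U\<close> a point
  of the cube of all functions from sets to \<open>{0..1}\<close>, where Tychonoff's theorem
  applies.\<close>

definition rel_cov :: "'a set \<Rightarrow> 'a set \<Rightarrow> real" where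
  "rel_cov U A = (if A \<subseteq> carrier G then real (cov U A) / real (cov U (carrier G)) else 0)"

text \<open>A cluster point of the net \<open>rel_cov U\<close> as \<open>U\<close> shrinks to
  \<open>\<one>\<close>. The closures have the finite intersection property in the compact cube,
  because a finite intersection of neighbourhoods is again a neighbourhood.\<close>

lemma ex_limit_content:
  "\<exists>c :: 'a set \<Rightarrow> real. \<forall>V \<in> nbhds_one. c \<in> closure (rel_cov ` {U \<in> nbhds_one. U \<subseteq> V})"
proof -
  let ?S = "PiE UNIV (\<lambda>_. {0..1}) :: ('a set \<Rightarrow> real) set"
  let ?C = "\<lambda>V. closure (rel_cov ` {U \<in> nbhds_one. U \<subseteq> V})"
  have "compactin (product_topology (\<lambda>_. euclidean) UNIV) ?S"
    by (subst compactin_PiE) auto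
  then have S: "compact ?S"
    by (simp add: euclidean_product_topology)
  have in01: "rel_cov U \<in> ?S" if U: "U \<in> nbhds_one" for U
    using cov_carrier_pos[OF U] cov_mono[OF U subset_refl] by (auto simp: rel_cov_def)
  have "?S \<inter> \<Inter>(?C ` nbhds_one) \<noteq> {}"
  proof (rule compact_imp_fip[OF S])
    fix F' assume "finite F'" "F' \<subseteq> ?C ` nbhds_one"
    then obtain \<V> where V: "finite \<V>" "\<V> \<subseteq> nbhds_one" "F' = ?C ` \<V>"
      by (meson finite_subset_image)
    let ?U = "carrier G \<inter> \<Inter>\<V>"
    have "openin T (\<Inter>\<V>)" if "\<V> \<noteq> {}"
      using that V by (intro openin_Inter) (auto simp: nbhds_one_def)
    then have "openin T ?U"
      using openin_topspace[of T] topspace_eq by (cases "\<V> = {}") (auto intro: openin_Int)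
    then have U: "?U \<in> nbhds_one"
      using V by (auto simp: nbhds_one_def)
    have "rel_cov ?U \<in> ?C W" if "W \<in> \<V>" for W
      using that U by (intro subsetD[OF closure_subset] imageI) auto
    then show "?S \<inter> \<Inter>F' \<noteq> {}"
      using in01[OF U] V by blast
  qed auto
  then show ?thesis by blast
qed

definition haar_content :: "'a set \<Rightarrow> real" where
  "haar_content = (SOME c. \<forall>V \<in> nbhds_one. c \<in> closure (rel_cov ` {U \<in> nbhds_one. U \<subseteq> V}))"

text \<open>Closed conditions that hold for all small \<open>U\<close> survive in the limit. In the
  product topology evaluation at a set is continuous, so equations and weak inequalities between
  finitely many values are closed.\<close>

lemma haar_content_limit:
  assumes V: "V \<in> nbhds_one" and P: "closed {c. P c}"
    and ev: "\<And>U. U \<in> nbhds_one \<Longrightarrow> U \<subseteq> V \<Longrightarrow> P (rel_cov U)"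
  shows "P haar_content"
proof -
  have "haar_content \<in> closure (rel_cov ` {U \<in> nbhds_one. U \<subseteq> V})"
    using someI_ex[OF ex_limit_content] V unfolding haar_content_def by blast
  also have "\<dots> \<subseteq> {c. P c}"
    using ev by (intro closure_minimal P) auto
  finally show ?thesis by simp
qed

lemma carrier_nbhd_one: "carrier G \<in> nbhds_one"
  using openin_topspace[of T] topspace_eq by (auto simp: nbhds_one_def)

lemmas haar_content_limit' = haar_content_limit[OF carrier_nbhd_one]

lemma closed_content_haar: "closed_content T haar_content"
proof
  show "compact_space T" "normal_space T" by (rule compact normal)+
  fix K assume K: "closedin T K"
  note K' = closedin_subset_carrier[OF K]
  show "0 \<le> haar_content K"
    by (rule haar_content_limit') (auto intro!: closed_Collect_le continuous_intros simp: rel_cov_def)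
  fix L assume L: "closedin T L"
  note L' = closedin_subset_carrier[OF L]
  show "haar_content K \<le> haar_content L" if "K \<subseteq> L"
    by (rule haar_content_limit')
       (use that K' L' in \<open>auto intro!: closed_Collect_le continuous_intros divide_right_mono cov_mono
          simp: rel_cov_def\<close>)
  have sub: "rel_cov U (K \<union> L) \<le> rel_cov U K + rel_cov U L" if "U \<in> nbhds_one" for U
    using cov_Un[OF that K' L'] K' L'
    by (auto simp: rel_cov_def add_divide_distrib[symmetric] intro!: divide_right_mono)
  show "haar_content (K \<union> L) \<le> haar_content K + haar_content L"
    by (rule haar_content_limit') (auto intro!: closed_Collect_le continuous_intros sub)
  show "haar_content (K \<union> L) = haar_content K + haar_content L" if KL: "disjnt K L"
  proof -
    \<comment> \<open>For a fixed \<open>U\<close> the covering numbers are merely subadditive.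
      Exact additivity begins once \<open>U\<close> lies inside a \<open>V\<close> that depends on
      \<open>K\<close> and \<open>L\<close>.\<close>
    obtain V where V: "V \<in> nbhds_one"
      "\<And>U a. U \<subseteq> V \<Longrightarrow> a \<in> carrier G \<Longrightarrow> (U #> a) \<inter> K = {} \<or> (U #> a) \<inter> L = {}"
      using separating_nbhd[OF K L KL] by blast
    show ?thesis
    proof (rule haar_content_limit[OF V(1)])
      fix U assume U: "U \<in> nbhds_one" "U \<subseteq> V"
      have "cov U K + cov U L = cov U (K \<union> L)"
        using cov_disjoint[OF U(1) K' L' V(2)[OF U(2)]] cov_Un[OF U(1) K' L'] by simp
      then show "rel_cov U (K \<union> L) = rel_cov U K + rel_cov U L"
        using K' L' by (auto simp: rel_cov_def add_divide_distrib[symmetric])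
    qed (auto intro!: closed_Collect_eq continuous_intros)
  qed
qed

theorem ex_right_haar_measure: "\<exists>N. right_haar_measure G T N"
proof (rule exI, rule right_haar_measure_radon[OF closed_content_haar])
  show "haar_content (carrier G) = 1"
    by (rule haar_content_limit')
       (auto intro!: closed_Collect_eq continuous_intros simp: rel_cov_def dest: cov_carrier_pos)
  fix K g assume K: "closedin T K" and g: "g \<in> carrier G"
  note K' = closedin_subset_carrier[OF K]
  show "haar_content (K #> g) = haar_content K"
    by (rule haar_content_limit')
       (use K' g r_coset_subset_G[OF K' g] in
         \<open>auto intro!: closed_Collect_eq continuous_intros simp: rel_cov_def cov_translate\<close>)
qed

end


section \<open>Integrals of separately continuous functions\<close>

lemma openin_dist_less:
  fixes f g :: "'a \<Rightarrow> 'b::metric_space"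
  assumes "continuous_map X euclidean f"
  shows "openin X {x \<in> topspace X. dist (f x) c < e}"
proof -
  have "openin X {x \<in> topspace X. f x \<in> ball c e}"
    by (rule openin_continuous_map_preimage[OF assms]) simp
  then show ?thesis by (simp add: dist_commute)
qed

lemma continuous_map_euclidean_dist:
  fixes f :: "'a \<Rightarrow> 'b::metric_space"
  assumes "\<And>x e. x \<in> topspace X \<Longrightarrow> 0 < e \<Longrightarrow>
    \<exists>W. openin X W \<and> x \<in> W \<and> (\<forall>y\<in>W. dist (f y) (f x) < e)"
  shows "continuous_map X euclidean f"
  unfolding continuous_map_def
proof (intro conjI allI impI)
  fix S :: "'b set" assume "openin euclidean S"
  then have S: "open S" by simp
  show "openin X {x \<in> topspace X. f x \<in> S}"
  proof (subst openin_subopen, intro ballI)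
    fix x assume x: "x \<in> {x \<in> topspace X. f x \<in> S}"
    then obtain e where e: "0 < e" "ball (f x) e \<subseteq> S"
      using S open_contains_ball by blast
    obtain W where W: "openin X W" "x \<in> W" "\<forall>y\<in>W. dist (f y) (f x) < e"
      using assms[of x e] x e by auto
    then have "W \<subseteq> {x \<in> topspace X. f x \<in> S}"
      using e openin_subset[OF W(1)] by (auto simp: dist_commute subset_iff)
    then show "\<exists>T. openin X T \<and> x \<in> T \<and> T \<subseteq> {x \<in> topspace X. f x \<in> S}"
      using W by blast
  qed
qed auto

text \<open>A sequence in a general compact space need not have a convergent subsequence; a cluster
  point along the index set \<open>A\<close> replaces one. If each point had a neighbourhood visited
  only finitely often, a finite subcover would make \<open>A\<close> finite.\<close>

lemma compactin_cluster_point: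
  assumes K: "compactin X K" and A: "infinite A" and s: "\<And>n. n \<in> A \<Longrightarrow> s n \<in> K"
  shows "\<exists>x\<in>K. \<forall>W. openin X W \<longrightarrow> x \<in> W \<longrightarrow> infinite {n \<in> A. s n \<in> W}"
proof (rule ccontr)
  assume neg: "\<not> ?thesis"
  have "\<exists>W. openin X W \<and> x \<in> W \<and> finite {n \<in> A. s n \<in> W}" if "x \<in> K" for x
    using that neg by blast
  then obtain W where W: "\<And>x. x \<in> K \<Longrightarrow> openin X (W x)" "\<And>x. x \<in> K \<Longrightarrow> x \<in> W x"
    "\<And>x. x \<in> K \<Longrightarrow> finite {n \<in> A. s n \<in> W x}"
    by metis
  have "\<exists>\<F>. finite \<F> \<and> \<F> \<subseteq> W ` K \<and> K \<subseteq> \<Union>\<F>"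
    by (rule compactinD[OF K]) (use W in auto)
  then obtain F where F: "finite F" "F \<subseteq> K" "K \<subseteq> \<Union>(W ` F)"
    by (metis finite_subset_image)
  then have "A \<subseteq> (\<Union>x\<in>F. {n \<in> A. s n \<in> W x})"
    using s by fastforce
  moreover have "finite (\<Union>x\<in>F. {n \<in> A. s n \<in> W x})"
    using F W by auto
  ultimately show False
    using A finite_subset by blast
qed

lemma openin_finite_Ball:
  assumes "finite J" "\<And>j. j \<in> J \<Longrightarrow> openin X {x \<in> topspace X. P j x}"
  shows "openin X {x \<in> topspace X. \<forall>j\<in>J. P j x}"
  using assms
proof (induction J rule: finite_induct)
  case (insert j J)
  have "{x \<in> topspace X. \<forall>i\<in>insert j J. P i x} = {x \<in> topspace X. P j x} \<inter> {x \<in> topspace X. \<forall>i\<in>J. P i x}"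
    by auto
  then show ?case using insert by (simp add: openin_Int)
qed simp

text \<open>Total boundedness of the image of \<open>X\<close> under the finitely many functions
  indexed by \<open>J\<close>, with the centres of the net taken in \<open>X\<close>.\<close>

lemma compact_space_finite_net:
  fixes g :: "'a \<Rightarrow> 'b \<Rightarrow> 'c::metric_space"
  assumes X: "compact_space X" and J: "finite J" and e: "0 < e"
    and g: "\<And>y. y \<in> J \<Longrightarrow> continuous_map X euclidean (\<lambda>x. g x y)"
  shows "\<exists>F. finite F \<and> F \<subseteq> topspace X \<and>
    (\<forall>x\<in>topspace X. \<exists>x'\<in>F. \<forall>y\<in>J. dist (g x y) (g x' y) < e)"
proof -
  let ?W = "\<lambda>x'. {x \<in> topspace X. \<forall>y\<in>J. dist (g x y) (g x' y) < e}"
  have "\<exists>\<F>. finite \<F> \<and> \<F> \<subseteq> ?W ` topspace X \<and> topspace X \<subseteq> \<Union>\<F>"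
  proof (rule compactinD[OF X[unfolded compact_space_def]])
    fix U assume "U \<in> ?W ` topspace X"
    then obtain x' where "U = ?W x'" by blast
    then show "openin X U"
      by (simp only:) (intro openin_finite_Ball openin_dist_less J g)
  next
    show "topspace X \<subseteq> \<Union>(?W ` topspace X)"
      using e by force
  qed
  then obtain \<F> where "finite \<F>" "\<F> \<subseteq> ?W ` topspace X" "topspace X \<subseteq> \<Union>\<F>"
    by (elim exE conjE)
  moreover then obtain F where "finite F" "F \<subseteq> topspace X" "\<F> = ?W ` F"
    by (meson finite_subset_image)
  ultimately have F: "finite F" "F \<subseteq> topspace X" "topspace X \<subseteq> \<Union>(?W ` F)"
    by simp_all
  show ?thesis
    by (intro exI[of _ F]) (use F in blast)
qed

text \<open>Grothendieck's interchange of limits. The sequence \<open>y\<close> is close to \<open>y0\<close> on finite nets \<open>F n\<close>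
  that themselves resolve the functions \<open>g \<cdot> (y j)\<close>; hence every cluster point of \<open>y\<close> defines the
  same function on \<open>X\<close> as \<open>y0\<close>.\<close>

lemma separately_continuous_tendsto:
  fixes g :: "'a \<Rightarrow> 'b \<Rightarrow> 'c::metric_space"
  assumes X: "compact_space X" and K: "compactin Y K"
    and g1: "\<And>y. y \<in> topspace Y \<Longrightarrow> continuous_map X euclidean (\<lambda>x. g x y)"
    and g2: "\<And>x. x \<in> topspace X \<Longrightarrow> continuous_map Y euclidean (g x)"
    and y0: "y0 \<in> topspace Y" and y: "\<And>n. y n \<in> K" and F: "\<And>n. F n \<subseteq> topspace X"
    and close: "\<And>m n x. m < n \<Longrightarrow> x \<in> F m \<Longrightarrow> dist (g x (y n)) (g x y0) < 1 / real (Suc n)"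
    and net: "\<And>n x. x \<in> topspace X \<Longrightarrow> \<exists>x'\<in>F n. dist (g x y0) (g x' y0) < 1 / real (Suc n) \<and>
        (\<forall>j\<le>n. dist (g x (y j)) (g x' (y j)) < 1 / real (Suc n))"
    and x: "x \<in> topspace X"
  shows "(\<lambda>n. g x (y n)) \<longlonglongrightarrow> g x y0"
proof (rule ccontr)
  have KY: "K \<subseteq> topspace Y"
    using K compactin_subset_topspace by blast
  have yY: "y n \<in> topspace Y" for n
    using y KY by blast
  have small: "\<exists>N. \<forall>n\<ge>N. 1 / real (Suc n) < e" if pos: "0 < e" for e
  proof -
    obtain N where "1 / real (Suc N) < e"
      using nat_approx_posE[OF pos] .
    moreover have "1 / real (Suc n) \<le> 1 / real (Suc N)" if "N \<le> n" for n
      using that by (intro divide_left_mono) auto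
    ultimately show ?thesis
      by (meson le_less_trans)
  qed
  assume "\<not> (\<lambda>n. g x (y n)) \<longlonglongrightarrow> g x y0"
  then obtain d where d: "0 < d" and inf: "infinite {n. d \<le> dist (g x (y n)) (g x y0)}" (is "infinite ?A")
    unfolding tendsto_iff cofinite_eq_sequentially[symmetric] eventually_cofinite
    by (auto simp: not_less)
  \<comment> \<open>The cluster point is taken along the bad indices \<open>?A\<close>, so that
    \<open>g x ys = g x y0\<close> will already be contradictory.\<close>
  obtain ys where ys: "ys \<in> K"
    "\<forall>W. openin Y W \<longrightarrow> ys \<in> W \<longrightarrow> infinite {n \<in> ?A. y n \<in> W}"
    using compactin_cluster_point[where s = y, OF K inf y] by (elim bexE)
  have ysY: "ys \<in> topspace Y"
    using ys KY by blast
  have ys_cluster: "\<exists>n\<in>?A. n > N \<and> y n \<in> W" if "openin Y W" "ys \<in> W" for N W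
    using ys(2)[rule_format, OF that] unfolding infinite_nat_iff_unbounded by auto
  have nbhd_ys: "\<exists>n\<in>?A. n > N \<and> dist (g z (y n)) (g z ys) < e \<and> dist (g w (y n)) (g w ys) < e"
    if "0 < e" "z \<in> topspace X" "w \<in> topspace X" for N e z w
  proof -
    have "openin Y ({v \<in> topspace Y. dist (g z v) (g z ys) < e} \<inter> {v \<in> topspace Y. dist (g w v) (g w ys) < e})"
      using that by (intro openin_Int openin_dist_less g2)
    from ys_cluster[OF this, of N] show ?thesis
      using that ysY by auto
  qed
  \<comment> \<open>Each net \<open>F m\<close> is fixed while \<open>n\<close> grows, so
    \<open>g x' (y n)\<close> tends to \<open>g x' y0\<close>; by continuity in the second variable
    \<open>g x' ys\<close> is a cluster value of the same sequence.\<close>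
  have on_F: "g x' ys = g x' y0" if x': "x' \<in> F m" for x' m
  proof (rule ccontr)
    assume "g x' ys \<noteq> g x' y0"
    then have e: "0 < dist (g x' ys) (g x' y0) / 2" (is "0 < ?e") by simp
    obtain N where N: "\<forall>n\<ge>N. 1 / real (Suc n) < ?e"
      using small[OF e] by blast
    have x'X: "x' \<in> topspace X"
      using F x' by (rule subsetD)
    obtain n where n: "n > max N m" "dist (g x' (y n)) (g x' ys) < ?e"
      using nbhd_ys[OF e x'X x'X, of "max N m"] by (elim bexE conjE)
    have "dist (g x' (y n)) (g x' y0) < ?e"
      using n by (intro less_trans[OF close[OF _ x'] N[rule_format]]) auto
    then show False
      using n dist_triangle3[of "g x' ys" "g x' y0" "g x' (y n)"] by simp
  qed
  obtain xs where xs: "\<And>k. xs k \<in> F k" "\<And>k. dist (g x y0) (g (xs k) y0) < 1 / real (Suc k)"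
    "\<And>k j. j \<le> k \<Longrightarrow> dist (g x (y j)) (g (xs k) (y j)) < 1 / real (Suc k)"
    using net[OF x] by metis
  \<comment> \<open>The points \<open>xs k\<close> of the nets approximate \<open>x\<close> as seen
    by \<open>y0\<close> and by \<open>y j\<close> for \<open>j \<le> k\<close>. Their cluster point
    \<open>x'\<close> is indistinguishable from \<open>x\<close> at \<open>y0\<close> and at every
    \<open>y j\<close>.\<close>
  obtain x' where x': "x' \<in> topspace X"
    "\<forall>W. openin X W \<longrightarrow> x' \<in> W \<longrightarrow> infinite {k \<in> UNIV. xs k \<in> W}"
  proof -
    have "xs k \<in> topspace X" for k
      using xs(1) F by blast
    then show ?thesis
      using compactin_cluster_point[where s = xs, OF X[unfolded compact_space_def] infinite_UNIV_nat]
        that by blast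
  qed
  have nbhd_x': "\<exists>k>N. dist (g (xs k) v) (g x' v) < e \<and> dist (g (xs k) w) (g x' w) < e"
    if "0 < e" "v \<in> topspace Y" "w \<in> topspace Y" for N e v w
  proof -
    have "openin X ({z \<in> topspace X. dist (g z v) (g x' v) < e} \<inter> {z \<in> topspace X. dist (g z w) (g x' w) < e})"
      using that by (intro openin_Int openin_dist_less g1)
    from x'(2)[rule_format, OF this] show ?thesis
      using that x'(1) unfolding infinite_nat_iff_unbounded by auto
  qed
  have eq_y: "g x' (y j) = g x (y j)" for j
  proof (rule ccontr)
    assume "g x' (y j) \<noteq> g x (y j)"
    then have e: "0 < dist (g x' (y j)) (g x (y j)) / 2" (is "0 < ?e") by simp
    obtain N where N: "\<forall>n\<ge>N. 1 / real (Suc n) < ?e"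
      using small[OF e] by blast
    obtain k where k: "k > max N j" "dist (g (xs k) (y j)) (g x' (y j)) < ?e"
      using nbhd_x'[OF e yY yY] by blast
    have "dist (g x (y j)) (g (xs k) (y j)) < ?e"
      using k by (intro less_trans[OF xs(3) N[rule_format]]) auto
    then show False
      using k dist_triangle3[of "g x' (y j)" "g x (y j)" "g (xs k) (y j)"] by (simp add: dist_commute)
  qed
  have eq_y0: "g x' y0 = g x y0"
  proof (rule ccontr)
    assume "g x' y0 \<noteq> g x y0"
    then have e: "0 < dist (g x' y0) (g x y0) / 2" (is "0 < ?e") by simp
    obtain N where N: "\<forall>n\<ge>N. 1 / real (Suc n) < ?e"
      using small[OF e] by blast
    obtain k where k: "k > N" "dist (g (xs k) y0) (g x' y0) < ?e"
      using nbhd_x'[OF e y0 y0] by blast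
    have "dist (g x y0) (g (xs k) y0) < ?e"
      using k by (intro less_trans[OF xs(2) N[rule_format]]) auto
    then show False
      using k dist_triangle3[of "g x' y0" "g x y0" "g (xs k) y0"] by (simp add: dist_commute)
  qed
  have eq_ys: "g x' ys = g x ys"
  proof (rule ccontr)
    assume "g x' ys \<noteq> g x ys"
    then have e: "0 < dist (g x' ys) (g x ys) / 2" (is "0 < ?e") by simp
    obtain n where n: "dist (g x' (y n)) (g x' ys) < ?e" "dist (g x (y n)) (g x ys) < ?e"
      using nbhd_ys[OF e x'(1) x] by blast
    then show False
      using dist_triangle3[of "g x' ys" "g x ys" "g x (y n)"] by (simp add: eq_y)
  qed
  \<comment> \<open>Every \<open>xs k\<close> lies in a net, where \<open>ys\<close> and
    \<open>y0\<close> give equal values by \<open>on_F\<close>; continuity in the first variable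
    carries the equality to \<open>x'\<close>.\<close>
  have eq': "g x' ys = g x' y0"
  proof (rule ccontr)
    assume "g x' ys \<noteq> g x' y0"
    then have e: "0 < dist (g x' ys) (g x' y0) / 2" (is "0 < ?e") by simp
    obtain k where k: "dist (g (xs k) ys) (g x' ys) < ?e" "dist (g (xs k) y0) (g x' y0) < ?e"
      using nbhd_x'[OF e ysY y0] by blast
    then show False
      using dist_triangle3[of "g x' ys" "g x' y0" "g (xs k) y0"] on_F[OF xs(1)[of k]] by simp
  qed
  have "g x ys = g x y0"
    using eq_ys eq' eq_y0 by simp
  moreover obtain n where "n \<in> ?A" "dist (g x (y n)) (g x ys) < d"
    using nbhd_ys[OF d x x] by blast
  ultimately show False by simp
qed

text \<open>If continuity fails at \<open>y0\<close>, points with integral at least \<open>e\<close>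
  away exist in every neighbourhood of \<open>y0\<close>. A sequence of them is chosen so close to
  \<open>y0\<close> on finite nets that it converges pointwise; dominated convergence then
  contradicts the distance \<open>e\<close>. Local compactness of \<open>Y\<close> keeps the
  sequence in one compact set.\<close>

theorem continuous_map_integral_separately_continuous:
  fixes g :: "'a \<Rightarrow> 'b \<Rightarrow> 'c::{banach, second_countable_topology}"
  assumes X: "compact_space X" and Y: "locally_compact_space Y"
    and N: "finite_measure N" "sets N = sets (borel_of X)"
    and g1: "\<And>y. y \<in> topspace Y \<Longrightarrow> continuous_map X euclidean (\<lambda>x. g x y)"
    and g2: "\<And>x. x \<in> topspace X \<Longrightarrow> continuous_map Y euclidean (g x)"
    and B: "\<And>x y. x \<in> topspace X \<Longrightarrow> y \<in> topspace Y \<Longrightarrow> norm (g x y) \<le> B"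
  shows "continuous_map Y euclidean (\<lambda>y. integral\<^sup>L N (\<lambda>x. g x y))"
proof (rule continuous_map_euclidean_dist, rule ccontr)
  interpret finite_measure N by fact
  define I where "I = (\<lambda>y. integral\<^sup>L N (\<lambda>x. g x y))"
  fix y0 e assume y0: "y0 \<in> topspace Y" and e: "0 < (e::real)"
    and neg: "\<nexists>W. openin Y W \<and> y0 \<in> W \<and>
      (\<forall>y\<in>W. dist (integral\<^sup>L N (\<lambda>x. g x y)) (integral\<^sup>L N (\<lambda>x. g x y0)) < e)"
  have neg': "\<exists>y\<in>W. e \<le> dist (I y) (I y0)" if "openin Y W" "y0 \<in> W" for W
    using neg that by (auto simp: I_def not_less)
  obtain U K where U: "openin Y U" "y0 \<in> U" "U \<subseteq> K" and K: "compactin Y K"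
    using Y[unfolded locally_compact_space_def, rule_format, OF y0] by (elim exE conjE)
  have UY: "U \<subseteq> topspace Y"
    using U openin_subset by blast
  \<comment> \<open>The pair \<open>r\<close> consists of the \<open>n\<close>th point and the
    \<open>n\<close>th net. Well-founded choice lets the condition depend on \<open>f\<close> only
    below \<open>n\<close>, so the condition for the new point \<open>fst r\<close> is stated
    separately; together with \<open>j < n\<close> it gives the range \<open>j \<le> n\<close>
    needed later.\<close>
  define P :: "(nat \<Rightarrow> 'b \<times> 'a set) \<Rightarrow> nat \<Rightarrow> 'b \<times> 'a set \<Rightarrow> bool" where
    "P = (\<lambda>f n r. fst r \<in> U \<and> e \<le> dist (I (fst r)) (I y0) \<and>
      (\<forall>m<n. \<forall>x\<in>snd (f m). dist (g x (fst r)) (g x y0) < 1 / real (Suc n)) \<and>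
      finite (snd r) \<and> snd r \<subseteq> topspace X \<and>
      (\<forall>x\<in>topspace X. \<exists>x'\<in>snd r. dist (g x y0) (g x' y0) < 1 / real (Suc n) \<and>
        dist (g x (fst r)) (g x' (fst r)) < 1 / real (Suc n) \<and>
        (\<forall>j<n. dist (g x (fst (f j))) (g x' (fst (f j))) < 1 / real (Suc n))))"
  have "\<exists>f. \<forall>n. P f n (f n)"
  proof (rule dependent_wellorder_choice)
    fix r :: "'b \<times> 'a set" and f h :: "nat \<Rightarrow> 'b \<times> 'a set" and n
    assume "\<And>m. m < n \<Longrightarrow> f m = h m"
    then show "P f n r = P h n r"
      unfolding P_def by simp
  next
    fix n and f :: "nat \<Rightarrow> 'b \<times> 'a set"
    assume IH: "\<And>m. m < n \<Longrightarrow> P f m (f m)"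
    let ?Z = "\<Union>m<n. snd (f m)"
    have fin: "finite ?Z" "?Z \<subseteq> topspace X"
      using IH by (auto simp: P_def)
    \<comment> \<open>Closeness on the earlier nets is finitely many open conditions satisfied by
      \<open>y0\<close>, hence defines a neighbourhood, which contains a bad point.\<close>
    let ?W = "U \<inter> {y \<in> topspace Y. \<forall>x\<in>?Z. dist (g x y) (g x y0) < 1 / real (Suc n)}"
    have oW: "openin Y ?W"
      using fin by (intro openin_Int U openin_finite_Ball openin_dist_less g2) auto
    have y0W: "y0 \<in> ?W"
      using U y0 by simp
    obtain y where "y \<in> ?W" "e \<le> dist (I y) (I y0)"
      using neg'[OF oW y0W] by (elim bexE)
    then have y: "y \<in> U" "\<forall>x\<in>?Z. dist (g x y) (g x y0) < 1 / real (Suc n)"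
      "e \<le> dist (I y) (I y0)"
      by simp_all
    let ?J = "{y0, y} \<union> (\<lambda>j. fst (f j)) ` {..<n}"
    have "?J \<subseteq> topspace Y"
      using y0 y UY IH by (auto simp: P_def)
    then have "\<exists>F. finite F \<and> F \<subseteq> topspace X \<and>
        (\<forall>x\<in>topspace X. \<exists>x'\<in>F. \<forall>y\<in>?J. dist (g x y) (g x' y) < 1 / real (Suc n))"
      by (intro compact_space_finite_net[OF X] g1) auto
    then obtain F where F: "finite F" "F \<subseteq> topspace X"
      "\<forall>x\<in>topspace X. \<exists>x'\<in>F. \<forall>y\<in>?J. dist (g x y) (g x' y) < 1 / real (Suc n)"
      by blast
    have "P f n (y, F)"
      unfolding P_def fst_conv snd_conv
    proof (intro conjI ballI)
      fix x assume "x \<in> topspace X"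
      then obtain x' where "x' \<in> F" "\<forall>y\<in>?J. dist (g x y) (g x' y) < 1 / real (Suc n)"
        using F by blast
      then show "\<exists>x'\<in>F. dist (g x y0) (g x' y0) < 1 / real (Suc n) \<and>
          dist (g x y) (g x' y) < 1 / real (Suc n) \<and>
          (\<forall>j<n. dist (g x (fst (f j))) (g x' (fst (f j))) < 1 / real (Suc n))"
        by (intro bexI[of _ x']) auto
    qed (use y F in auto)
    then show "\<exists>r. P f n r" by blast
  qed
  then obtain f where f: "\<And>n. P f n (f n)" by blast
  have yU: "fst (f n) \<in> U" and far: "e \<le> dist (I (fst (f n))) (I y0)" for n
    using f[of n] by (simp_all add: P_def)
  have lim: "(\<lambda>n. g x (fst (f n))) \<longlonglongrightarrow> g x y0" if x: "x \<in> topspace X" for x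
  proof (rule separately_continuous_tendsto[OF X K g1 g2 y0 _ _ _ _ x, where F = "\<lambda>n. snd (f n)"])
    show "fst (f n) \<in> K" for n using yU U by blast
    show "snd (f n) \<subseteq> topspace X" for n using f[of n] by (simp add: P_def)
    show "dist (g x (fst (f n))) (g x y0) < 1 / real (Suc n)" if "m < n" "x \<in> snd (f m)" for m n x
      using f[of n] that by (simp add: P_def)
    fix n x assume "x \<in> topspace X"
    then have "\<exists>x'\<in>snd (f n). dist (g x y0) (g x' y0) < 1 / real (Suc n) \<and>
        dist (g x (fst (f n))) (g x' (fst (f n))) < 1 / real (Suc n) \<and>
        (\<forall>j<n. dist (g x (fst (f j))) (g x' (fst (f j))) < 1 / real (Suc n))"
      using f[of n] by (simp only: P_def)
    then show "\<exists>x'\<in>snd (f n). dist (g x y0) (g x' y0) < 1 / real (Suc n) \<and>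
        (\<forall>j\<le>n. dist (g x (fst (f j))) (g x' (fst (f j))) < 1 / real (Suc n))"
      by (elim bexE conjE, intro bexI conjI) (auto simp: le_less)
  qed
  have space: "space N = topspace X"
    using sets_eq_imp_space_eq[OF N(2)] by (simp add: space_borel_of)
  have meas: "(\<lambda>x. g x y) \<in> borel_measurable N" if "y \<in> topspace Y" for y
    using continuous_map_borel_measurable[OF g1[OF that]] by (simp add: measurable_cong_sets[OF N(2) refl])
  have "(\<lambda>n. I (fst (f n))) \<longlonglongrightarrow> I y0"
    unfolding I_def
  proof (rule integral_dominated_convergence[where w = "\<lambda>_. B"])
    show "(\<lambda>x. g x y0) \<in> borel_measurable N" "\<And>n. (\<lambda>x. g x (fst (f n))) \<in> borel_measurable N"
      using meas y0 yU UY by blast+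
    show "AE x in N. (\<lambda>n. g x (fst (f n))) \<longlonglongrightarrow> g x y0"
      using lim by (intro AE_I2) (simp add: space)
    show "AE x in N. norm (g x (fst (f n))) \<le> B" for n
      using B yU UY by (intro AE_I2) (auto simp: space)
  qed simp
  then have "eventually (\<lambda>n. dist (I (fst (f n))) (I y0) < e) sequentially"
    using e by (rule tendstoD)
  then show False
    using far by (auto simp: not_less[symmetric] eventually_sequentially)
qed


section \<open>Averages over a compact normal subgroup\<close>

lemma Int_sets_subtopology_borel_of:
  assumes "E \<in> sets (borel_of T)"
  shows "E \<inter> H \<in> sets (borel_of (subtopology T H))"
proof -
  have "id \<in> measurable (borel_of (subtopology T H)) (borel_of T)"
    by (intro continuous_map_measurable_borel_of continuous_map_from_subtopology continuous_map_id)
  from measurable_sets[OF this assms] show ?thesis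
    using sets.sets_into_space[OF assms] by (simp add: space_borel_of Int_absorb2 Int_assoc[symmetric])
qed

lemma extend_measure_by_zero_complex_radon:
  assumes T: "Hausdorff_space T" and H: "H \<subseteq> topspace T"
    and N: "radon_probability (subtopology T H) N"
  shows "extend_measure_by_zero N \<in> complex_radon_measures T"
proof -
  have sets: "sets N = sets (borel_of (subtopology T H))"
    and reg: "inner_regular (subtopology T H) (emeasure N)"
    using N by (simp_all add: radon_probability_def)
  interpret prob_space N
    using N by (simp add: radon_probability_def)
  have space: "space N = H"
    using sets_eq_imp_space_eq[OF sets] H by (auto simp: space_borel_of)
  have ext: "extend_measure_by_zero N E = complex_of_real (measure N (E \<inter> H))" for E
    by (simp add: extend_measure_by_zero_def space)
  have Int: "E \<inter> H \<in> sets N" if "E \<in> sets (borel_of T)" for E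
    unfolding sets by (rule Int_sets_subtopology_borel_of[OF that])
  have cm: "complex_measure (borel_of T) (extend_measure_by_zero N)"
    unfolding complex_measure_def ext
  proof (intro conjI allI impI)
    fix F :: "nat \<Rightarrow> 'a set" assume F: "range F \<subseteq> sets (borel_of T)" "disjoint_family F"
    have "(\<lambda>i. measure N (F i \<inter> H)) sums measure N (\<Union>i. F i \<inter> H)"
    proof (rule finite_measure_UNION)
      show "range (\<lambda>i. F i \<inter> H) \<subseteq> sets N"
        using F Int by auto
      show "disjoint_family (\<lambda>i. F i \<inter> H)"
        using F(2) by (auto simp: disjoint_family_on_def)
    qed
    then show "(\<lambda>i. complex_of_real (measure N (F i \<inter> H))) sums
        complex_of_real (measure N ((\<Union>i. F i) \<inter> H))"
      by (simp add: sums_of_real)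
  qed simp
  \<comment> \<open>A positive measure is its own total variation: every partition yields the same
    sum, so the supremum is over a constant family. The partition into \<open>E\<close> and empty
    sets shows that the family is nonempty.\<close>
  have tv: "total_variation (borel_of T) (extend_measure_by_zero N) E = emeasure N (E \<inter> H)"
    if E: "E \<in> sets (borel_of T)" for E
  proof -
    let ?P = "{F :: nat \<Rightarrow> 'a set. range F \<subseteq> sets (borel_of T) \<and> disjoint_family F \<and> (\<Union>i. F i) = E}"
    have "(\<lambda>i. if i = 0 then E else {}) \<in> ?P"
      using E by (auto simp: disjoint_family_on_def split: if_splits)
    then have ne: "?P \<noteq> {}" by blast
    have "(\<Sum>i. ennreal (cmod (extend_measure_by_zero N (F i)))) = emeasure N (E \<inter> H)"
      if F: "F \<in> ?P" for F
    proof -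
      have "(\<Sum>i. ennreal (cmod (extend_measure_by_zero N (F i)))) = (\<Sum>i. emeasure N (F i \<inter> H))"
        by (simp add: ext emeasure_eq_measure)
      also have "\<dots> = emeasure N (\<Union>i. F i \<inter> H)"
      proof (rule suminf_emeasure)
        show "range (\<lambda>i. F i \<inter> H) \<subseteq> sets N"
          using F Int by auto
        show "disjoint_family (\<lambda>i. F i \<inter> H)"
          using F by (auto simp: disjoint_family_on_def)
      qed
      also have "(\<Union>i. F i \<inter> H) = E \<inter> H"
        using F by auto
      finally show ?thesis .
    qed
    then have "total_variation (borel_of T) (extend_measure_by_zero N) E
        = (SUP F\<in>?P. emeasure N (E \<inter> H))"
      unfolding total_variation_def by (intro SUP_cong refl)
    also have "\<dots> = emeasure N (E \<inter> H)"
      using ne by (rule SUP_const)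
    finally show ?thesis .
  qed
  have "inner_regular T (total_variation (borel_of T) (extend_measure_by_zero N))"
    unfolding inner_regular_def
  proof (intro ballI antisym)
    fix E assume E: "E \<in> sets (borel_of T)"
    have cb: "K \<in> sets (borel_of T)" if "compactin T K" for K
      using compactin_imp_closedin[OF T that] by (rule closedin_sets_borel_of)
    let ?S = "SUP K\<in>{K. compactin T K \<and> K \<subseteq> E}. total_variation (borel_of T) (extend_measure_by_zero N) K"
    have "emeasure N (E \<inter> H) = (SUP K\<in>{K. compactin (subtopology T H) K \<and> K \<subseteq> E \<inter> H}. emeasure N K)"
      using reg Int_sets_subtopology_borel_of[OF E, of H] by (simp add: inner_regular_def)
    also have "\<dots> \<le> ?S"
    proof (rule SUP_least)
      fix K assume "K \<in> {K. compactin (subtopology T H) K \<and> K \<subseteq> E \<inter> H}"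
      then have K: "compactin T K" "K \<subseteq> E" "K \<subseteq> H"
        by (auto simp: compactin_subtopology)
      then have "emeasure N K = total_variation (borel_of T) (extend_measure_by_zero N) K"
        using tv[OF cb[OF K(1)]] by (simp add: Int_absorb2)
      also have "\<dots> \<le> ?S"
        using K by (intro SUP_upper) auto
      finally show "emeasure N K \<le> ?S" .
    qed
    finally show "total_variation (borel_of T) (extend_measure_by_zero N) E \<le> ?S"
      by (simp add: tv[OF E])
    show "?S \<le> total_variation (borel_of T) (extend_measure_by_zero N) E"
    proof (rule SUP_least)
      fix K assume K: "K \<in> {K. compactin T K \<and> K \<subseteq> E}"
      then have "emeasure N (K \<inter> H) \<le> emeasure N (E \<inter> H)"
        using Int[OF E] by (intro emeasure_mono) auto
      then show "total_variation (borel_of T) (extend_measure_by_zero N) K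
          \<le> total_variation (borel_of T) (extend_measure_by_zero N) E"
        using K cb tv E by auto
    qed
  qed
  with cm show ?thesis
    by (simp add: complex_radon_measures_def)
qed

lemma (in right_topological_group) integral_right_translation:
  fixes f :: "'a \<Rightarrow> 'c::{banach, second_countable_topology}"
  assumes N: "right_haar_measure G T N" and f: "f \<in> borel_measurable N" and h: "h \<in> carrier G"
  shows "integral\<^sup>L N (\<lambda>x. f (x \<otimes> h)) = integral\<^sup>L N f"
proof -
  have sets: "sets N = sets (borel_of T)"
    and inv: "\<And>g E. g \<in> carrier G \<Longrightarrow> E \<in> sets (borel_of T) \<Longrightarrow> emeasure N (E #> g) = emeasure N E"
    using N by (auto simp: right_haar_measure_def radon_probability_def)
  have space: "space N = carrier G"
    using sets_eq_imp_space_eq[OF sets] by (simp add: space_borel_of topspace_eq)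
  have m: "(\<lambda>x. x \<otimes> h) \<in> measurable N N"
    using continuous_map_measurable_borel_of[OF continuous_right_translation[OF h]]
    by (simp add: measurable_cong_sets[OF sets sets])
  have "distr N N (\<lambda>x. x \<otimes> h) = N"
  proof (rule measure_eqI)
    fix E assume "E \<in> sets (distr N N (\<lambda>x. x \<otimes> h))"
    then have E: "E \<in> sets N" by simp
    have "E \<subseteq> carrier G"
      using sets.sets_into_space[OF E] by (simp add: space)
    then have "(\<lambda>x. x \<otimes> h) -` E \<inter> space N = E #> inv h"
      using h by (force simp: space r_coset_def m_assoc)
    then show "emeasure (distr N N (\<lambda>x. x \<otimes> h)) E = emeasure N E"
      using E h by (simp add: emeasure_distr[OF m] inv sets)
  qed simp
  then show ?thesis
    using integral_distr[OF m f] by simp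
qed

lemma compact_group_subgroup:
  assumes "Hausdorff_space T" "compactin T H"
    and "topological_group (G\<lparr>carrier := H\<rparr>) (subtopology T H)"
  shows "compact_group (G\<lparr>carrier := H\<rparr>) (subtopology T H)"
  unfolding compact_group_def compact_group_axioms_def
  using assms compact_Hausdorff_or_regular_imp_normal_space
    [of "subtopology T H"] compact_space_subtopology Hausdorff_space_subtopology by blast

text \<open>The common setting for both alternatives of the theorem, since a compact space is
  locally compact.\<close>

locale compact_normal_subgroup = right_topological_group G T + normal H G
  for G (structure) and T H +
  assumes Hausdorff: "Hausdorff_space T"
    and locally_compact: "locally_compact_space T"
    and center: "H \<subseteq> topological_center G T"
    and compactin_H: "compactin T H"
    and topological_group_H: "topological_group (G\<lparr>carrier := H\<rparr>) (subtopology T H)"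
begin

abbreviation haar_H :: "'a measure" where
  "haar_H \<equiv> normalized_haar G T H"

lemma topspace_H: "topspace (subtopology T H) = H"
  using subset by (auto simp: topspace_eq)

lemma right_haar_measure_H: "right_haar_measure (G\<lparr>carrier := H\<rparr>) (subtopology T H) haar_H"
  unfolding normalized_haar_def
  using compact_group.ex_right_haar_measure
    [OF compact_group_subgroup[OF Hausdorff compactin_H topological_group_H]]
  by (rule someI_ex)

lemma radon_probability_H: "radon_probability (subtopology T H) haar_H"
  and sets_haar_H: "sets haar_H = sets (borel_of (subtopology T H))"
  and prob_space_haar_H: "prob_space haar_H"
  using right_haar_measure_H by (simp_all add: right_haar_measure_def radon_probability_def)

lemma space_haar_H: "space haar_H = H"
  using sets_eq_imp_space_eq[OF sets_haar_H] topspace_H by (simp add: space_borel_of)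

text \<open>This is \<open>f\<close> acted on by the measure of \<open>H\<close>. Values in an
  arbitrary Banach space allow complex \<open>f\<close> for the spaces of measures and real
  \<open>f\<close> for the functional behind Haar measure.\<close>

definition average :: "('a \<Rightarrow> 'c::{banach, second_countable_topology}) \<Rightarrow> 'a \<Rightarrow> 'c" where
  "average f y = integral\<^sup>L haar_H (\<lambda>x. f (x \<otimes> y))"

lemma continuous_map_translate:
  assumes "continuous_map T X f" "y \<in> carrier G"
  shows "continuous_map T X (\<lambda>x. f (x \<otimes> y))"
  using continuous_map_compose[OF continuous_right_translation[OF assms(2)] assms(1)]
  by (simp add: o_def)

lemma continuous_map_translate_H:
  assumes "continuous_map T X f" "y \<in> carrier G"
  shows "continuous_map (subtopology T H) X (\<lambda>x. f (x \<otimes> y))"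
  by (intro continuous_map_from_subtopology continuous_map_translate assms)

lemma continuous_left_translation: "h \<in> H \<Longrightarrow> continuous_map T T (\<lambda>y. h \<otimes> y)"
  using center by (auto simp: topological_center_def)

lemma measurable_translate:
  fixes f :: "'a \<Rightarrow> 'c::topological_space"
  assumes "continuous_map T euclidean f" "y \<in> carrier G"
  shows "(\<lambda>x. f (x \<otimes> y)) \<in> borel_measurable haar_H"
  using continuous_map_borel_measurable[OF continuous_map_translate_H[OF assms]]
  by (simp add: measurable_cong_sets[OF sets_haar_H refl])

lemma norm_translate_le:
  assumes "\<And>x. x \<in> carrier G \<Longrightarrow> norm (f x) \<le> B" "y \<in> carrier G"
  shows "AE x in haar_H. norm (f (x \<otimes> y)) \<le> B"
  using assms subset by (intro AE_I2) (auto simp: space_haar_H)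

lemma integrable_translate:
  fixes f :: "'a \<Rightarrow> 'c::{banach, second_countable_topology}"
  assumes "continuous_map T euclidean f" "\<And>x. x \<in> carrier G \<Longrightarrow> norm (f x) \<le> B" "y \<in> carrier G"
  shows "integrable haar_H (\<lambda>x. f (x \<otimes> y))"
proof -
  interpret prob_space haar_H by (rule prob_space_haar_H)
  show ?thesis
    using norm_translate_le[of f B, OF assms(2,3)] measurable_translate[OF assms(1,3)]
    by (rule integrable_const_bound)
qed

lemma continuous_map_average:
  fixes f :: "'a \<Rightarrow> 'c::{banach, second_countable_topology}"
  assumes f: "continuous_map T euclidean f" and B: "\<And>x. x \<in> carrier G \<Longrightarrow> norm (f x) \<le> B"
  shows "continuous_map T euclidean (average f)"
  unfolding average_def
proof (rule continuous_map_integral_separately_continuous[OF _ locally_compact _ sets_haar_H])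
  show "compact_space (subtopology T H)"
    using compactin_H by (rule compact_space_subtopology)
  show "finite_measure haar_H"
    using prob_space_haar_H by (rule prob_space.axioms)
  show "continuous_map (subtopology T H) euclidean (\<lambda>x. f (x \<otimes> y))" if "y \<in> topspace T" for y
    using that by (intro continuous_map_translate_H f) (simp add: topspace_eq)
  show "continuous_map T euclidean (\<lambda>y. f (x \<otimes> y))" if "x \<in> topspace (subtopology T H)" for x
  proof -
    have "continuous_map T T (\<lambda>y. x \<otimes> y)"
      using that by (intro continuous_left_translation) (simp add: topspace_H)
    from continuous_map_compose[OF this f] show ?thesis
      by (simp add: o_def)
  qed
  show "norm (f (x \<otimes> y)) \<le> B" if "x \<in> topspace (subtopology T H)" "y \<in> topspace T" for x y
    using that subset by (intro B) (auto simp: topspace_eq)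
qed

lemma norm_average_le:
  fixes f :: "'a \<Rightarrow> 'c::{banach, second_countable_topology}"
  assumes f: "continuous_map T euclidean f" and B: "\<And>x. x \<in> carrier G \<Longrightarrow> norm (f x) \<le> B"
    and y: "y \<in> carrier G"
  shows "norm (average f y) \<le> B"
proof -
  interpret prob_space haar_H by (rule prob_space_haar_H)
  have "norm (average f y) \<le> (LINT x|haar_H. norm (f (x \<otimes> y)))"
    unfolding average_def by (rule integral_norm_bound)
  also have "\<dots> \<le> (LINT x|haar_H. B)"
    using integrable_translate[of f B, OF f B y] norm_translate_le[of f B, OF B y]
    by (intro integral_mono_AE integrable_norm) auto
  also have "\<dots> = B" by (simp add: prob_space)
  finally show ?thesis .
qed

text \<open>The integration variable stands to the left of \<open>y\<close>, so a factor
  \<open>h\<close> in front of \<open>y\<close> acts on it as a right translation of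
  \<open>H\<close>.\<close>

lemma average_left_invariant:
  fixes f :: "'a \<Rightarrow> 'c::{banach, second_countable_topology}"
  assumes f: "continuous_map T euclidean f" and h: "h \<in> H" and y: "y \<in> carrier G"
  shows "average f (h \<otimes> y) = average f y"
proof -
  interpret HG: topological_group "G\<lparr>carrier := H\<rparr>" "subtopology T H"
    by (rule topological_group_H)
  have "average f (h \<otimes> y) = (LINT x|haar_H. f ((x \<otimes> h) \<otimes> y))"
    unfolding average_def using h y subset
    by (intro Bochner_Integration.integral_cong refl) (auto simp: space_haar_H m_assoc)
  also have "\<dots> = average f y"
    unfolding average_def
    using HG.integral_right_translation[OF right_haar_measure_H measurable_translate[OF f y], of h] h
    by simp
  finally show ?thesis .
qed

lemma fun_dot_measure_lambda_sub:
  assumes f: "continuous_map T euclidean f" and y: "y \<in> topspace T"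
  shows "fun_dot_measure G T f (lambda_sub G T H) y = average f y"
  unfolding fun_dot_measure_def lambda_sub_def average_def
proof (rule complex_integral_extend_measure_by_zero[OF _ sets_haar_H])
  show "finite_measure haar_H"
    using prob_space_haar_H by (rule prob_space.axioms)
  show "H \<subseteq> topspace T"
    using subset by (simp add: topspace_eq)
  show "continuous_map T euclidean (\<lambda>x. f (x \<otimes> y))"
    using y by (intro continuous_map_translate f) (simp add: topspace_eq)
qed

lemma lambda_sub_complex_radon: "lambda_sub G T H \<in> complex_radon_measures T"
  unfolding lambda_sub_def
  using subset
  by (intro extend_measure_by_zero_complex_radon[OF Hausdorff _ radon_probability_H]) (simp add: topspace_eq)

lemma lambda_sub_in_M_space: "lambda_sub G T H \<in> M_space G T"
  unfolding M_space_def
proof (intro CollectI conjI ballI lambda_sub_complex_radon)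
  fix f assume "f \<in> bounded_continuous_functions T"
  then have f: "continuous_map T euclidean f" and "bounded (f ` topspace T)"
    by (auto simp: bounded_continuous_functions_def)
  then obtain B where B: "\<And>x. x \<in> carrier G \<Longrightarrow> norm (f x) \<le> B"
    unfolding bounded_iff by (auto simp: topspace_eq)
  have "continuous_map T euclidean (fun_dot_measure G T f (lambda_sub G T H))"
    using continuous_map_average[of f B, OF f B]
    by (rule continuous_map_eq) (simp_all add: fun_dot_measure_lambda_sub[OF f])
  moreover have "bounded (fun_dot_measure G T f (lambda_sub G T H) ` topspace T)"
    unfolding bounded_iff
    by (intro exI[of _ B])
       (use norm_average_le[of f B, OF f B] in \<open>auto simp: fun_dot_measure_lambda_sub[OF f] topspace_eq\<close>)
  ultimately show "fun_dot_measure G T f (lambda_sub G T H) \<in> bounded_continuous_functions T"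
    by (simp add: bounded_continuous_functions_def)
qed

end


section \<open>The topology of cosets\<close>

context right_topological_group
begin

section \<open>Open sets and translations of the \<sigma>-topology\<close>

lemma openin_sigma_topology:
  "openin (sigma_topology G X) W \<longleftrightarrow> W \<subseteq> (\<lambda>(x, y). inv x \<otimes> y) ` (topspace X \<times> topspace X) \<and>
    openin (prod_topology X X) {p \<in> topspace X \<times> topspace X. inv (fst p) \<otimes> snd p \<in> W}"
  unfolding sigma_topology_def openin_quotient_topology by (simp add: case_prod_beta)

lemma division_image: "(\<lambda>(x, y). inv x \<otimes> y) ` (carrier G \<times> carrier G) = carrier G"
proof
  show "carrier G \<subseteq> (\<lambda>(x, y). inv x \<otimes> y) ` (carrier G \<times> carrier G)"
    by (rule subsetI, rule image_eqI[where x = "(\<one>, _)"]) auto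
qed auto

lemma openin_sigma:
  "openin (sigma_topology G T) W \<longleftrightarrow> W \<subseteq> carrier G \<and>
    openin (prod_topology T T) {p \<in> carrier G \<times> carrier G. inv (fst p) \<otimes> snd p \<in> W}"
  unfolding openin_sigma_topology by (simp add: topspace_eq division_image)

lemma openin_sigma_sigma:
  "openin (sigma_sigma_topology G T) W \<longleftrightarrow> W \<subseteq> carrier G \<and>
    openin (prod_topology (sigma_topology G T) (sigma_topology G T))
      {p \<in> carrier G \<times> carrier G. inv (fst p) \<otimes> snd p \<in> W}"
  unfolding openin_sigma_topology[of "sigma_topology G T"]
  by (simp add: topspace_sigma_topology[OF topspace_eq] division_image)

text \<open>On the slice \<open>x = \<one>\<close> the map \<open>(x, y) \<mapsto> x^-1 y\<close> is
  the identity in \<open>y\<close>.\<close>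

lemma openin_sigma_imp_openin:
  assumes W: "openin (sigma_topology G T) W"
  shows "openin T W"
proof -
  have "continuous_map T (prod_topology T T) (\<lambda>y. (\<one>, y))"
    by (intro continuous_map_pairedI) (auto simp: topspace_eq)
  from openin_continuous_map_preimage[OF this conjunct2[OF W[unfolded openin_sigma]]]
  have "openin T {y \<in> topspace T. (\<one>, y) \<in> {p \<in> carrier G \<times> carrier G. inv (fst p) \<otimes> snd p \<in> W}}" .
  also have "{y \<in> topspace T. (\<one>, y) \<in> {p \<in> carrier G \<times> carrier G. inv (fst p) \<otimes> snd p \<in> W}} = W"
    using W by (auto simp: openin_sigma topspace_eq)
  finally show ?thesis .
qed

text \<open>All left translations are \<sigma>-open, for \<open>g\<close> in the topological center
  or not: \<open>(x g)^-1 y = g^-1 (x^-1 y)\<close> converts a left translation of the quotient into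
  a right translation of the first factor, which is continuous in \<open>T\<close>.\<close>

lemma openin_sigma_left_translation:
  assumes W: "openin (sigma_topology G T) W" and g: "g \<in> carrier G"
  shows "openin (sigma_topology G T) ((\<lambda>u. g \<otimes> u) ` W)"
  unfolding openin_sigma
proof (intro conjI)
  have WG: "W \<subseteq> carrier G"
    using W by (simp add: openin_sigma)
  then show "(\<lambda>u. g \<otimes> u) ` W \<subseteq> carrier G"
    using g by auto
  have "continuous_map (prod_topology T T) (prod_topology T T) (\<lambda>p. (fst p \<otimes> g, snd p))"
    using continuous_map_compose[OF continuous_map_fst[of T T] continuous_right_translation[OF g]]
    by (intro continuous_map_pairedI) (auto simp: o_def continuous_map_snd)
  from openin_continuous_map_preimage[OF this conjunct2[OF W[unfolded openin_sigma]]]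
  have "openin (prod_topology T T) {p \<in> topspace (prod_topology T T).
    (fst p \<otimes> g, snd p) \<in> {p \<in> carrier G \<times> carrier G. inv (fst p) \<otimes> snd p \<in> W}}" .
  also have "{p \<in> topspace (prod_topology T T).
    (fst p \<otimes> g, snd p) \<in> {p \<in> carrier G \<times> carrier G. inv (fst p) \<otimes> snd p \<in> W}} =
    {p \<in> carrier G \<times> carrier G. inv (fst p) \<otimes> snd p \<in> (\<lambda>u. g \<otimes> u) ` W}"
  proof -
    have "inv (x \<otimes> g) \<otimes> y \<in> W \<longleftrightarrow> inv x \<otimes> y \<in> (\<lambda>u. g \<otimes> u) ` W"
      if "x \<in> carrier G" "y \<in> carrier G" for x y
    proof -
      have e: "g \<otimes> (inv (x \<otimes> g) \<otimes> y) = inv x \<otimes> y"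
        using that g by (simp add: inv_mult_group m_assoc[symmetric])
      show ?thesis
      proof
        assume "inv (x \<otimes> g) \<otimes> y \<in> W"
        then show "inv x \<otimes> y \<in> (\<lambda>u. g \<otimes> u) ` W"
          using e by (metis imageI)
      next
        assume "inv x \<otimes> y \<in> (\<lambda>u. g \<otimes> u) ` W"
        then obtain u where u: "u \<in> W" "inv x \<otimes> y = g \<otimes> u" by blast
        then have "u = inv g \<otimes> (inv x \<otimes> y)"
          using that g WG by (subst inv_solve_left) auto
        then have "u = inv (x \<otimes> g) \<otimes> y"
          using that g by (simp add: inv_mult_group m_assoc)
        then show "inv (x \<otimes> g) \<otimes> y \<in> W" using u by simp
      qed
    qed
    then show ?thesis
      using g by (auto simp: topspace_eq)
  qed
  finally show "openin (prod_topology T T)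
      {p \<in> carrier G \<times> carrier G. inv (fst p) \<otimes> snd p \<in> (\<lambda>u. g \<otimes> u) ` W}" .
qed

end

context compact_normal_subgroup
begin

section \<open>Saturated sets and separation of cosets\<close>

definition saturated :: "'a set \<Rightarrow> bool" where
  "saturated U \<longleftrightarrow> (\<forall>h\<in>H. \<forall>u\<in>U. h \<otimes> u \<in> U)"

definition saturation :: "'a set \<Rightarrow> 'a set" where
  "saturation U = (\<Union>h\<in>H. (\<lambda>u. h \<otimes> u) ` U)"

lemma H_carrier: "h \<in> H \<Longrightarrow> h \<in> carrier G"
  using subset by blast

lemma saturated_saturation: "U \<subseteq> carrier G \<Longrightarrow> saturated (saturation U)"
  unfolding saturated_def saturation_def
proof (intro ballI)
  fix h v assume U: "U \<subseteq> carrier G" and h: "h \<in> H" and "v \<in> (\<Union>h\<in>H. (\<lambda>u. h \<otimes> u) ` U)"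
  then obtain k u where k: "k \<in> H" "u \<in> U" "v = k \<otimes> u" by blast
  then have "h \<otimes> v = (h \<otimes> k) \<otimes> u"
    using h U H_carrier by (auto simp: m_assoc)
  then show "h \<otimes> v \<in> (\<Union>h\<in>H. (\<lambda>u. h \<otimes> u) ` U)"
    using h k by blast
qed

lemma subset_saturation: "U \<subseteq> carrier G \<Longrightarrow> U \<subseteq> saturation U"
  unfolding saturation_def by (force intro!: bexI[of _ \<one>])

text \<open>For \<open>h\<close> in \<open>H\<close> the inverse also lies in \<open>H\<close>,
  hence in the topological center, so left translation by \<open>h\<close> is open.\<close>

lemma openin_saturation:
  assumes U: "openin T U"
  shows "openin T (saturation U)"
proof -
  have UG: "U \<subseteq> carrier G"
    using U by (rule openin_subset_carrier)
  have "openin T ((\<lambda>u. h \<otimes> u) ` U)" if h: "h \<in> H" for h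
  proof -
    have "openin T {y \<in> topspace T. inv h \<otimes> y \<in> U}"
      using h by (intro openin_continuous_map_preimage[OF continuous_left_translation U]) auto
    also have "{y \<in> topspace T. inv h \<otimes> y \<in> U} = (\<lambda>u. h \<otimes> u) ` U"
    proof (intro equalityI subsetI)
      fix y assume "y \<in> {y \<in> topspace T. inv h \<otimes> y \<in> U}"
      then show "y \<in> (\<lambda>u. h \<otimes> u) ` U"
        using h H_carrier
        by (intro image_eqI[of _ _ "inv h \<otimes> y"]) (auto simp: topspace_eq m_assoc[symmetric])
    next
      fix y assume "y \<in> (\<lambda>u. h \<otimes> u) ` U"
      then obtain u where "u \<in> U" "y = h \<otimes> u" by blast
      moreover have "inv h \<otimes> (h \<otimes> u) = u"
        using calculation h UG H_carrier by (subst m_assoc[symmetric]) auto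
      ultimately show "y \<in> {y \<in> topspace T. inv h \<otimes> y \<in> U}"
        using h UG H_carrier by (auto simp: topspace_eq)
    qed
    finally show ?thesis .
  qed
  then show ?thesis
    unfolding saturation_def by (intro openin_Union) auto
qed

lemma openin_sigma_saturation:
  assumes "openin (sigma_topology G T) U"
  shows "openin (sigma_topology G T) (saturation U)"
  unfolding saturation_def using assms H_carrier
  by (intro openin_Union) (auto intro: openin_sigma_left_translation)

text \<open>The pullback to \<open>G\<close> of the quotient topology on the cosets of
  \<open>H\<close>. Staying on the carrier of \<open>G\<close> avoids transporting group, measure
  and functions to a quotient type of object, at the price of inseparable points within a
  coset.\<close>

definition coset_topology :: "'a topology" where
  "coset_topology = topology (\<lambda>U. openin T U \<and> saturated U)"

lemma openin_coset_topology: "openin coset_topology U \<longleftrightarrow> openin T U \<and> saturated U"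
proof -
  have "istopology (\<lambda>U. openin T U \<and> saturated U)"
    unfolding istopology_def saturated_def by (blast intro: openin_Int openin_Union)
  then show ?thesis
    by (simp add: coset_topology_def topology_inverse')
qed

lemma topspace_coset_topology: "topspace coset_topology = carrier G"
proof
  show "topspace coset_topology \<subseteq> carrier G"
    using openin_topspace[of coset_topology] unfolding openin_coset_topology
    by (intro openin_subset_carrier) simp
  have "openin coset_topology (carrier G)"
    using openin_topspace[of T] H_carrier by (auto simp: openin_coset_topology topspace_eq saturated_def)
  then show "carrier G \<subseteq> topspace coset_topology"
    by (rule openin_subset)
qed

lemma compact_space_coset_topology:
  assumes "compact_space T"
  shows "compact_space coset_topology"
  using assms unfolding compact_space_def compactin_def
  by (simp add: topspace_coset_topology topspace_eq openin_coset_topology)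

text \<open>\<open>\<sigma>\<sigma>\<close>-closedness of \<open>H\<close> says exactly that the quotient of \<open>(G, \<sigma>)\<close> by \<open>H\<close> is Hausdorff.\<close>

lemma separate_cosets:
  assumes H: "closedin (sigma_sigma_topology G T) H"
    and x: "x \<in> carrier G" and y: "y \<in> carrier G" and xy: "inv x \<otimes> y \<notin> H"
  obtains U V where "openin (sigma_topology G T) U" "saturated U" "x \<in> U"
    "openin (sigma_topology G T) V" "saturated V" "y \<in> V" "U \<inter> V = {}"
proof -
  let ?S = "sigma_topology G T"
  have "topspace (sigma_sigma_topology G T) = carrier G"
    by (intro topspace_sigma_topology topspace_eq)
  then have "openin (sigma_sigma_topology G T) (carrier G - H)"
    using H by (simp add: closedin_def)
  then have "openin (prod_topology ?S ?S) {p \<in> carrier G \<times> carrier G. inv (fst p) \<otimes> snd p \<in> carrier G - H}"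
    by (simp add: openin_sigma_sigma)
  moreover have "(x, y) \<in> {p \<in> carrier G \<times> carrier G. inv (fst p) \<otimes> snd p \<in> carrier G - H}"
    using x y xy by simp
  ultimately obtain U V where U: "openin ?S U" "x \<in> U" and V: "openin ?S V" "y \<in> V"
    and UV: "U \<times> V \<subseteq> {p \<in> carrier G \<times> carrier G. inv (fst p) \<otimes> snd p \<in> carrier G - H}"
    unfolding openin_prod_topology_alt by meson
  have UG: "U \<subseteq> carrier G" and VG: "V \<subseteq> carrier G"
    using U V by (simp_all add: openin_sigma)
  show ?thesis
  proof (rule that)
    show "openin ?S (saturation U)" "openin ?S (saturation V)"
      using U V by (auto intro: openin_sigma_saturation)
    show "saturated (saturation U)" "saturated (saturation V)"
      using UG VG by (auto intro: saturated_saturation)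
    show "x \<in> saturation U" "y \<in> saturation V"
      using U V UG VG subset_saturation by blast+
    show "saturation U \<inter> saturation V = {}"
    proof (rule ccontr)
      assume "saturation U \<inter> saturation V \<noteq> {}"
      then obtain h k u v where e: "h \<in> H" "k \<in> H" "u \<in> U" "v \<in> V" "h \<otimes> u = k \<otimes> v"
        unfolding saturation_def by blast
      have G: "h \<in> carrier G" "k \<in> carrier G" "u \<in> carrier G" "v \<in> carrier G"
        using e UG VG H_carrier by auto
      \<comment> \<open>A common point of the saturations makes \<open>u^-1 v\<close> a conjugate of
        an element of \<open>H\<close>, which normality puts back into \<open>H\<close>, against the
        choice of \<open>U \<times> V\<close>.\<close>
      have "v = inv k \<otimes> (h \<otimes> u)"
        using e(5) G by (simp add: m_assoc[symmetric])
      then have "inv u \<otimes> v = inv u \<otimes> (inv k \<otimes> h) \<otimes> u"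
        using G by (simp add: m_assoc)
      moreover have "inv u \<otimes> (inv k \<otimes> h) \<otimes> u \<in> H"
        using e G by (intro inv_op_closed1) auto
      ultimately show False
        using UV e by auto
    qed
  qed
qed

text \<open>The usual separation of a point from a compact set, with two topologies: the separating
  sets are \<sigma>-open, while the finite subcover comes from compactness of \<open>T\<close>. The
  set \<open>O'\<close> shows that \<open>U\<close> is \<sigma>-open, and the pair gives
  regularity.\<close>

lemma separate_coset_open:
  assumes T: "compact_space T" and H: "closedin (sigma_sigma_topology G T) H"
    and U: "openin coset_topology U" and x: "x \<in> U"
  obtains O' V where "openin (sigma_topology G T) O'" "saturated O'" "x \<in> O'"
    "openin (sigma_topology G T) V" "saturated V" "carrier G - U \<subseteq> V" "O' \<inter> V = {}"
proof -
  let ?S = "sigma_topology G T"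
  have UT: "openin T U" and Us: "saturated U"
    using U by (auto simp: openin_coset_topology)
  have UG: "U \<subseteq> carrier G"
    using UT by (rule openin_subset_carrier)
  let ?C = "carrier G - U"
  have C: "compactin T ?C"
    using closedin_diff[OF closedin_topspace UT]
    by (intro closedin_compact_space[OF T]) (simp add: topspace_eq)
  have "\<exists>A B. openin ?S A \<and> saturated A \<and> x \<in> A \<and> openin ?S B \<and> saturated B \<and> y \<in> B \<and> A \<inter> B = {}"
    (is "\<exists>A B. ?P y A B") if y: "y \<in> ?C" for y
  proof -
    have xG: "x \<in> carrier G" and yG: "y \<in> carrier G"
      using x y UG by auto
    have "inv x \<otimes> y \<notin> H"
    proof
      assume "inv x \<otimes> y \<in> H"
      \<comment> \<open>\<open>saturated\<close> speaks of left factors, so the element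
        \<open>inv x \<otimes> y\<close> of \<open>H\<close> is conjugated to the left of
        \<open>x\<close>, where it carries \<open>x\<close> to \<open>y\<close>.\<close>
      then have "x \<otimes> (inv x \<otimes> y) \<otimes> inv x \<in> H"
        using xG by (intro inv_op_closed2)
      then have "(x \<otimes> (inv x \<otimes> y) \<otimes> inv x) \<otimes> x \<in> U"
        using Us x unfolding saturated_def by blast
      also have "(x \<otimes> (inv x \<otimes> y) \<otimes> inv x) \<otimes> x = y"
        using xG yG by (simp add: m_assoc) (simp add: m_assoc[symmetric])
      finally show False using y by simp
    qed
    then show ?thesis
      by (rule separate_cosets[OF H xG yG]) blast
  qed
  then obtain A B where AB: "\<And>y. y \<in> ?C \<Longrightarrow> ?P y (A y) (B y)"
    by metis
  have "\<exists>\<F>. finite \<F> \<and> \<F> \<subseteq> B ` ?C \<and> ?C \<subseteq> \<Union>\<F>"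
  proof (rule compactinD[OF C])
    fix W assume "W \<in> B ` ?C"
    then obtain y where y: "y \<in> ?C" "W = B y" by blast
    then show "openin T W"
      using AB[OF y(1)] openin_sigma_imp_openin by blast
  next
    show "?C \<subseteq> \<Union>(B ` ?C)"
      using AB by blast
  qed
  then obtain \<F> where "finite \<F>" "\<F> \<subseteq> B ` ?C" "?C \<subseteq> \<Union>\<F>"
    by (elim exE conjE)
  moreover then obtain F where "finite F" "F \<subseteq> ?C" "\<F> = B ` F"
    by (meson finite_subset_image)
  ultimately have F: "finite F" "F \<subseteq> ?C" "?C \<subseteq> \<Union>(B ` F)"
    by simp_all
  have P: "?P y (A y) (B y)" if "y \<in> F" for y
    using AB F that by blast
  have topS: "topspace ?S = carrier G"
    by (intro topspace_sigma_topology topspace_eq)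
  show ?thesis
  proof (rule that)
    have "openin ?S (\<Inter>(A ` F))" if "F \<noteq> {}"
      using that F(1) P by (intro openin_Inter) auto
    then show "openin ?S (carrier G \<inter> \<Inter>(A ` F))"
      using openin_topspace[of ?S] topS by (cases "F = {}") (auto intro: openin_Int)
    show "saturated (carrier G \<inter> \<Inter>(A ` F))"
      using P H_carrier unfolding saturated_def by auto
    show "x \<in> carrier G \<inter> \<Inter>(A ` F)"
      using P x UG by auto
    show "openin ?S (\<Union>(B ` F))"
      using P by (intro openin_Union) auto
    show "saturated (\<Union>(B ` F))"
      using P unfolding saturated_def by blast
    show "?C \<subseteq> \<Union>(B ` F)" by (rule F(3))
    show "(carrier G \<inter> \<Inter>(A ` F)) \<inter> \<Union>(B ` F) = {}"
      using P by blast
  qed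
qed

lemma openin_coset_topology_imp_sigma:
  assumes T: "compact_space T" and H: "closedin (sigma_sigma_topology G T) H"
    and U: "openin coset_topology U"
  shows "openin (sigma_topology G T) U"
proof (subst openin_subopen, intro ballI)
  fix x assume "x \<in> U"
  then obtain O' V where *: "openin (sigma_topology G T) O'" "x \<in> O'" "carrier G - U \<subseteq> V" "O' \<inter> V = {}"
    by (rule separate_coset_open[OF T H U]) 
  moreover have "O' \<subseteq> carrier G"
    using *(1) by (simp add: openin_sigma)
  ultimately show "\<exists>O'. openin (sigma_topology G T) O' \<and> x \<in> O' \<and> O' \<subseteq> U"
    by blast
qed

lemma regular_space_coset_topology:
  assumes T: "compact_space T" and H: "closedin (sigma_sigma_topology G T) H"
  shows "regular_space coset_topology"
  unfolding regular_space_def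
proof (intro allI impI)
  fix C x assume "closedin coset_topology C \<and> x \<in> topspace coset_topology - C"
  then have C: "C \<subseteq> carrier G" "openin coset_topology (carrier G - C)" "x \<in> carrier G - C"
    by (auto simp: closedin_def topspace_coset_topology)
  obtain U V where "openin (sigma_topology G T) U" "saturated U" "x \<in> U"
    "openin (sigma_topology G T) V" "saturated V" "carrier G - (carrier G - C) \<subseteq> V" "U \<inter> V = {}"
    by (rule separate_coset_open[OF T H C(2,3)])
  then show "\<exists>U V. openin coset_topology U \<and> openin coset_topology V \<and> x \<in> U \<and> C \<subseteq> V \<and> disjnt U V"
    using C by (intro exI[of _ U] exI[of _ V])
      (auto simp: openin_coset_topology openin_sigma_imp_openin disjnt_def)
qed

text \<open>A saturated \<open>T\<close>-open \<open>W\<close> is \<sigma>-open, which by definition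
  of \<sigma> means that its preimage is open for \<open>T \<times> T\<close>. Only the step from
  open rectangles to saturated open rectangles remains.\<close>

lemma continuous_map_division:
  assumes T: "compact_space T" and H: "closedin (sigma_sigma_topology G T) H"
  shows "continuous_map (prod_topology coset_topology coset_topology) coset_topology
    (\<lambda>p. inv (fst p) \<otimes> snd p)"
  unfolding continuous_map_def
proof (intro conjI allI impI)
  show "(\<lambda>p. inv (fst p) \<otimes> snd p) \<in>
      topspace (prod_topology coset_topology coset_topology) \<rightarrow> topspace coset_topology"
    by (auto simp: topspace_coset_topology)
  fix W assume W: "openin coset_topology W"
  let ?P = "{p \<in> carrier G \<times> carrier G. inv (fst p) \<otimes> snd p \<in> W}"
  have sat: "saturated W"
    using W by (simp add: openin_coset_topology)
  have "openin (prod_topology T T) ?P"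
    using openin_coset_topology_imp_sigma[OF T H W] by (simp add: openin_sigma)
  then have P: "\<exists>U V. openin T U \<and> openin T V \<and> x \<in> U \<and> y \<in> V \<and> U \<times> V \<subseteq> ?P" if "(x, y) \<in> ?P" for x y
    using that unfolding openin_prod_topology_alt by blast
  have "openin (prod_topology coset_topology coset_topology) ?P"
    unfolding openin_prod_topology_alt
  proof (intro allI impI)
    fix x y assume xy: "(x, y) \<in> ?P"
    obtain U V where UV: "openin T U" "openin T V" "x \<in> U" "y \<in> V" "U \<times> V \<subseteq> ?P"
      using P[OF xy] by (elim exE conjE)
    have UG: "U \<subseteq> carrier G" and VG: "V \<subseteq> carrier G"
      using UV by (auto dest: openin_subset_carrier)
    have "saturation U \<times> saturation V \<subseteq> ?P"
    proof
      fix p assume "p \<in> saturation U \<times> saturation V"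
      then obtain h k u v where e: "h \<in> H" "k \<in> H" "u \<in> U" "v \<in> V" "p = (h \<otimes> u, k \<otimes> v)"
        unfolding saturation_def by auto
      have G: "h \<in> carrier G" "k \<in> carrier G" "u \<in> carrier G" "v \<in> carrier G"
        using e UG VG H_carrier by auto
      have "inv u \<otimes> v \<in> W"
        using UV e by auto
      \<comment> \<open>Changing \<open>u\<close>, \<open>v\<close> to \<open>h \<otimes> u\<close>,
        \<open>k \<otimes> v\<close> multiplies \<open>inv u \<otimes> v\<close> on the left by this
        conjugate, which lies in \<open>H\<close> by normality and so preserves
        \<open>W\<close>.\<close>
      moreover have "inv u \<otimes> (inv h \<otimes> k) \<otimes> u \<in> H"
        using e G by (intro inv_op_closed1) auto
      ultimately have "(inv u \<otimes> (inv h \<otimes> k) \<otimes> u) \<otimes> (inv u \<otimes> v) \<in> W"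
        using sat unfolding saturated_def by blast
      also have "(inv u \<otimes> (inv h \<otimes> k) \<otimes> u) \<otimes> (inv u \<otimes> v) = inv (h \<otimes> u) \<otimes> (k \<otimes> v)"
      proof -
        have "u \<otimes> (inv u \<otimes> v) = v"
          using G by (simp add: m_assoc[symmetric])
        then show ?thesis
          using G by (simp add: inv_mult_group m_assoc)
      qed
      finally show "p \<in> ?P"
        using e G by simp
    qed
    then show "\<exists>U V. openin coset_topology U \<and> openin coset_topology V \<and> x \<in> U \<and> y \<in> V \<and> U \<times> V \<subseteq> ?P"
      using UV UG VG subset_saturation[OF UG] subset_saturation[OF VG]
      by (intro exI[of _ "saturation U"] exI[of _ "saturation V"])
        (auto simp: openin_coset_topology openin_saturation saturated_saturation)
  qed
  then show "openin (prod_topology coset_topology coset_topology)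
      {p \<in> topspace (prod_topology coset_topology coset_topology). inv (fst p) \<otimes> snd p \<in> W}"
    by (simp add: topspace_coset_topology)
qed

lemma compact_group_coset_topology:
  assumes T: "compact_space T" and H: "closedin (sigma_sigma_topology G T) H"
  shows "compact_group G coset_topology"
proof
  let ?S = coset_topology
  note d = continuous_map_division[OF T H]
  show "topspace ?S = carrier G" by (rule topspace_coset_topology)
  have "continuous_map ?S (prod_topology ?S ?S) (\<lambda>x. (x, \<one>))"
    by (intro continuous_map_pairedI) (auto simp: topspace_coset_topology)
  from continuous_map_compose[OF this d]
  have "continuous_map ?S ?S (\<lambda>x. inv x \<otimes> \<one>)"
    by (simp add: o_def)
  then show inv: "continuous_map ?S ?S (\<lambda>x. inv x)"
    by (rule continuous_map_eq) (simp add: topspace_coset_topology)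
  have "continuous_map (prod_topology ?S ?S) (prod_topology ?S ?S) (\<lambda>p. (inv (fst p), snd p))"
    using continuous_map_compose[OF continuous_map_fst inv, of ?S]
    by (intro continuous_map_pairedI) (auto simp: o_def continuous_map_snd)
  from continuous_map_compose[OF this d]
  have "continuous_map (prod_topology ?S ?S) ?S (\<lambda>p. inv (inv (fst p)) \<otimes> snd p)"
    by (simp add: o_def)
  then show "continuous_map (prod_topology ?S ?S) ?S (\<lambda>(x, y). x \<otimes> y)"
    by (rule continuous_map_eq) (auto simp: topspace_coset_topology)
  show comp: "compact_space ?S"
    using T by (rule compact_space_coset_topology)
  show "normal_space ?S"
    using comp regular_space_coset_topology[OF T H]
    by (intro compact_Hausdorff_or_regular_imp_normal_space) auto
qed

lemma continuous_map_average_coset: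
  fixes f :: "'a \<Rightarrow> 'c::{banach, second_countable_topology}"
  assumes f: "continuous_map T euclidean f" and B: "\<And>x. x \<in> carrier G \<Longrightarrow> norm (f x) \<le> B"
  shows "continuous_map coset_topology euclidean (average f)"
  unfolding continuous_map_def
proof (intro conjI allI impI)
  fix W :: "'c set" assume W: "openin euclidean W"
  have "openin T {x \<in> topspace T. average f x \<in> W}"
    using openin_continuous_map_preimage[OF continuous_map_average[of f B, OF f B] W] .
  moreover have "saturated {x \<in> topspace T. average f x \<in> W}"
    using average_left_invariant[OF f] H_carrier by (auto simp: saturated_def topspace_eq)
  ultimately show "openin coset_topology {x \<in> topspace coset_topology. average f x \<in> W}"
    by (simp add: openin_coset_topology topspace_coset_topology topspace_eq)
qed auto

lemma compact_bounded:
  fixes f :: "'a \<Rightarrow> 'c::real_normed_vector"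
  assumes "compact_space T" "continuous_map T euclidean f"
  obtains B where "\<And>x. x \<in> carrier G \<Longrightarrow> norm (f x) \<le> B"
proof -
  have "compactin euclidean (f ` topspace T)"
    using assms by (intro image_compactin[of T]) (auto simp: compact_space_def)
  then have "bounded (f ` carrier G)"
    by (simp add: compact_imp_bounded topspace_eq)
  then show ?thesis
    using that unfolding bounded_iff by auto
qed

lemma lambda_sub_in_M_sigma_space:
  assumes T: "compact_space T" and H: "closedin (sigma_sigma_topology G T) H"
  shows "lambda_sub G T H \<in> M_sigma_space G T"
  unfolding M_sigma_space_def
proof (intro CollectI conjI ballI lambda_sub_complex_radon)
  fix f assume "f \<in> continuous_functions T"
  then have f: "continuous_map T euclidean f"
    by (simp add: continuous_functions_def)
  obtain B where B: "\<And>x. x \<in> carrier G \<Longrightarrow> norm (f x) \<le> B"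
    using compact_bounded[OF T f] by blast
  have topS: "topspace (sigma_topology G T) = carrier G"
    by (intro topspace_sigma_topology topspace_eq)
  have "continuous_map (sigma_topology G T) euclidean (average f)"
    using continuous_map_average_coset[of f B, OF f B] openin_coset_topology_imp_sigma[OF T H]
    by (simp add: continuous_map_def topS topspace_coset_topology)
  then have "continuous_map (sigma_topology G T) euclidean (fun_dot_measure G T f (lambda_sub G T H))"
    by (rule continuous_map_eq) (simp add: fun_dot_measure_lambda_sub[OF f] topS topspace_eq)
  then show "fun_dot_measure G T f (lambda_sub G T H) \<in> continuous_functions (sigma_topology G T)"
    by (simp add: continuous_functions_def)
qed

lemma ex_right_haar_measure:
  assumes T: "compact_space T" and H: "closedin (sigma_sigma_topology G T) H"
  shows "\<exists>N. right_haar_measure G T N"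
proof -
  interpret S: compact_group G coset_topology
    by (rule compact_group_coset_topology[OF T H])
  obtain N where N: "right_haar_measure G coset_topology N"
    using S.ex_right_haar_measure by blast
  then have sets_N: "sets N = sets (borel_of coset_topology)"
    by (simp add: right_haar_measure_def radon_probability_def)
  interpret N: prob_space N
    using N by (simp add: right_haar_measure_def radon_probability_def)
  have space_N: "space N = carrier G"
    using sets_eq_imp_space_eq[OF sets_N] by (simp add: space_borel_of topspace_coset_topology)
  \<comment> \<open>Weil's integration formula: first over \<open>H\<close>, then over the quotient,
    whose Haar measure is represented by \<open>N\<close> on the coset topology.\<close>
  define J :: "('a \<Rightarrow> real) \<Rightarrow> real" where "J = (\<lambda>f. LINT y|N. average f y)"
  have meas: "average f \<in> borel_measurable N" if f: "continuous_map T euclidean f" for f :: "'a \<Rightarrow> real"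
  proof -
    obtain B where B: "\<And>x. x \<in> carrier G \<Longrightarrow> norm (f x) \<le> B"
      using compact_bounded[OF T f] by blast
    show ?thesis
      using continuous_map_borel_measurable[OF continuous_map_average_coset[of f B, OF f B]]
      by (simp add: measurable_cong_sets[OF sets_N refl])
  qed
  have int: "integrable N (average f)" if f: "continuous_map T euclidean f" for f :: "'a \<Rightarrow> real"
  proof -
    obtain B where B: "\<And>x. x \<in> carrier G \<Longrightarrow> norm (f x) \<le> B"
      using compact_bounded[OF T f] by blast
    have "AE y in N. norm (average f y) \<le> B"
      using norm_average_le[of f B, OF f B] by (intro AE_I2) (simp add: space_N)
    then show ?thesis
      using meas[OF f] by (rule N.integrable_const_bound)
  qed
  have intH: "integrable haar_H (\<lambda>x. f (x \<otimes> y))" if f: "continuous_map T euclidean f" and y: "y \<in> carrier G"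
    for f :: "'a \<Rightarrow> real" and y
  proof -
    obtain B where B: "\<And>x. x \<in> carrier G \<Longrightarrow> norm (f x) \<le> B"
      using compact_bounded[OF T f] by blast
    show ?thesis by (rule integrable_translate[of f B, OF f B y])
  qed
  have J_add: "J (\<lambda>x. f x + g x) = J f + J g"
    if f: "continuous_map T euclidean f" and g: "continuous_map T euclidean g" for f g
  proof -
    have "J (\<lambda>x. f x + g x) = (LINT y|N. average f y + average g y)"
      unfolding J_def average_def using intH[OF f] intH[OF g]
      by (intro Bochner_Integration.integral_cong refl Bochner_Integration.integral_add) (auto simp: space_N)
    also have "\<dots> = J f + J g"
      unfolding J_def by (intro Bochner_Integration.integral_add int f g)
    finally show ?thesis .
  qed
  have J_nonneg: "0 \<le> J f" if "continuous_map T euclidean f" "\<And>x. x \<in> topspace T \<Longrightarrow> 0 \<le> f x" for f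
    unfolding J_def average_def using that(2) subset
    by (intro integral_nonneg_AE AE_I2) (auto simp: space_N space_haar_H topspace_eq)
  have J_one: "J (\<lambda>_. 1) = 1"
    using prob_space.prob_space[OF prob_space_haar_H] N.prob_space by (simp add: J_def average_def)
  have J_translate: "J (\<lambda>x. f (x \<otimes> g)) = J f" if f: "continuous_map T euclidean f" and g: "g \<in> carrier G" for f g
  proof -
    \<comment> \<open>Averaging multiplies on the left and \<open>g\<close> on the right, so the two
      commute by associativity and right invariance of \<open>N\<close> finishes.\<close>
    have "J (\<lambda>x. f (x \<otimes> g)) = (LINT y|N. average f (y \<otimes> g))"
      unfolding J_def average_def using g H_carrier
      by (intro Bochner_Integration.integral_cong refl) (auto simp: space_N space_haar_H m_assoc)
    also have "\<dots> = J f"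
      unfolding J_def by (rule S.integral_right_translation[OF N meas[OF f] g])
    finally show ?thesis .
  qed
  let ?M = "\<lambda>K. {f :: 'a \<Rightarrow> real. continuous_map T euclidean f \<and> (\<forall>x\<in>topspace T. 0 \<le> f x) \<and> (\<forall>x\<in>K. 1 \<le> f x)}"
  let ?c = "\<lambda>K. INF f\<in>?M K. J f"
  have normal: "normal_space T"
    using T Hausdorff by (intro compact_Hausdorff_or_regular_imp_normal_space) auto
  note c = closed_content_functional[where J = J, OF T normal J_add J_nonneg]
  \<comment> \<open>The map \<open>f \<mapsto> (\<lambda>x. f (x \<otimes> g))\<close> sends test
    functions for \<open>K #> g\<close> to test functions for \<open>K\<close> with the same
    \<open>J\<close>. Using the inequality for \<open>inv g\<close> as well yields equality.\<close>
  have c_le: "?c K \<le> ?c (K #> g)" if K: "K \<subseteq> carrier G" and g: "g \<in> carrier G" for K g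
  proof (rule cINF_greatest)
    have "(\<lambda>_. 1) \<in> ?M (K #> g)" by simp
    then show "?M (K #> g) \<noteq> {}" by blast
    fix f assume f: "f \<in> ?M (K #> g)"
    then have fc: "continuous_map T euclidean f" by simp
    have "continuous_map T euclidean (\<lambda>x. f (x \<otimes> g))"
      using fc g by (rule continuous_map_translate)
    moreover have "\<forall>x\<in>K. 1 \<le> f (x \<otimes> g)"
      using f by (auto simp: r_coset_def)
    moreover have "\<forall>x\<in>topspace T. 0 \<le> f (x \<otimes> g)"
      using f g by (auto simp: topspace_eq)
    ultimately have "(\<lambda>x. f (x \<otimes> g)) \<in> ?M K" by simp
    moreover have "bdd_below (J ` ?M K)"
      by (rule bdd_belowI[of _ 0]) (auto intro: J_nonneg)
    ultimately have "?c K \<le> J (\<lambda>x. f (x \<otimes> g))"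
      by (intro cINF_lower)
    then show "?c K \<le> J f"
      by (simp add: J_translate[OF fc g])
  qed
  show ?thesis
  proof (rule exI, rule right_haar_measure_radon[OF c(1)])
    show "?c (carrier G) = 1"
      using c(2) unfolding J_one unfolding topspace_eq .
    fix K g assume K: "closedin T K" and g: "g \<in> carrier G"
    have KG: "K \<subseteq> carrier G"
      using K by (rule closedin_subset_carrier)
    have "?c (K #> g) \<le> ?c (K #> g #> inv g)"
      using KG g by (intro c_le r_coset_subset_G) auto
    also have "K #> g #> inv g = K"
      using KG g by (simp add: coset_mult_assoc)
    finally show "?c (K #> g) = ?c K"
      using c_le[OF KG g] by (rule antisym)
  qed
qed

end

theorem theorem4p13:
  fixes G :: "('a, 'b) monoid_scheme" and T :: "'a topology" and H :: "'a set"
  assumes "right_topological_group G T"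
    and "Hausdorff_space T"
    and "(locally_compact_space T \<and> sigma_compact_space T \<and> admissible G T) \<or> compact_space T"
    and "H \<subseteq> topological_center G T"
    and "H \<lhd> G"
    and "compactin T H"
    and "topological_group (G\<lparr>carrier := H\<rparr>) (subtopology T H)"
  shows "lambda_sub G T H \<in> M_space G T \<and>
    (compact_space T \<and> closedin (sigma_sigma_topology G T) H \<longrightarrow>
       lambda_sub G T H \<in> M_sigma_space G T \<and> (\<exists>\<nu>. right_haar_measure G T \<nu>))"
proof -
  have "locally_compact_space T"
    using assms(2,3) compact_imp_locally_compact_space by blast
  then interpret compact_normal_subgroup G T H
    using assms by (intro compact_normal_subgroup.intro compact_normal_subgroup_axioms.intro)
  show ?thesis
    using lambda_sub_in_M_space lambda_sub_in_M_sigma_space ex_right_haar_measure by blast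
qed

end
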